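(* If $\varphi\colon\Gamma\to G$ is a homomorphism of finite groups, then $\Gamma_{\infty,\varphi}$ is a finite group.
   Context: Composition is written right to left. A normal map (= crossed module) is a group homomorphism $n\colon M\to G$ together with a right action $m\mapsto m^g$ of $G$ on $M$ by automorphisms such that $n(m^g)=g^{-1}n(m)g$ and $m^{n(m')}=m'^{-1}mm'$ for all $m,m'\in M$, $g\in G$. Given normal maps $n\colon M\to G$ and $n'\colon M'\to G$, a normal morphism over $G$ is a homomorphism $\mu\colon M\to M'$ with $n'\circ\mu=n$ and $\mu(m^g)=\mu(m)^g$ for all $m\in M$, $g\in G$. The (free) normal closure of a homomorphism $\varphi\colon\Gamma\to G$ is the universal factorization $\Gamma\xrightarrow{c_\varphi}\Gamma^{\varphi}\xrightarrow{\overline{\varphi}}G$ of $\varphi$ with $\overline{\varphi}$ a normal map: for every factorization $\varphi=n\circ\psi$ with $\psi\colon\Gamma\to M$ a homomorphism and $n\colon M\to G$ a normal map there is a unique normal morphism $u\colon\Gamma^\varphi\to M$ over $G$ with $u\circ c_\varphi=\psi$. It exists and is unique up to unique isomorphism. The normal closures tower of $\varphi$ is defined by $\Gamma_1=\Gamma_{1,\varphi}=G$, $\varphi_1=\varphi$, and inductively $\Gamma_{i+1}=\Gamma_{i+1,\varphi}=\Gamma^{\varphi_i}$ (the normal closure of $\varphi_i\colon\Gamma\to\Gamma_i$), $\varphi_{i+1}=c_{\varphi_i}\colon\Gamma\to\Gamma_{i+1}$, with normal map $\overline{\varphi_i}\colon\Gamma_{i+1}\to\Gamma_i$. Then $\Gamma_\infty=\Gamma_{\infty,\varphi}=\varprojlim\Gamma_i$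 is the inverse limit of $\cdots\to\Gamma_3\to\Gamma_2\to\Gamma_1=G$. *)

theory Defs
  imports "HOL-Algebra.Algebra"
begin

section \<open>Normal maps and normal morphisms\<close>

locale normal_map = M: group M + G: group G
  for M :: "'m monoid" and G :: "'g monoid" +
  fixes n :: "'m \<Rightarrow> 'g" and act :: "'m \<Rightarrow> 'g \<Rightarrow> 'm"
  assumes n_hom: "n \<in> hom M G"
    and act_auto: "g \<in> carrier G \<Longrightarrow> (\<lambda>m. act m g) \<in> iso M M"
    and act_one: "m \<in> carrier M \<Longrightarrow> act m \<one>\<^bsub>G\<^esub> = m"
    and act_mult: "\<lbrakk>m \<in> carrier M; g \<in> carrier G; h \<in> carrier G\<rbrakk>
      \<Longrightarrow> act m (g \<otimes>\<^bsub>G\<^esub> h) = act (act m g) h"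
    and equivariant: "\<lbrakk>m \<in> carrier M; g \<in> carrier G\<rbrakk>
      \<Longrightarrow> n (act m g) = inv\<^bsub>G\<^esub> g \<otimes>\<^bsub>G\<^esub> n m \<otimes>\<^bsub>G\<^esub> g"
    and peiffer: "\<lbrakk>m \<in> carrier M; m' \<in> carrier M\<rbrakk>
      \<Longrightarrow> act m (n m') = inv\<^bsub>M\<^esub> m' \<otimes>\<^bsub>M\<^esub> m \<otimes>\<^bsub>M\<^esub> m'"

definition normal_morphism ::
    "'g monoid \<Rightarrow> 'm monoid \<Rightarrow> ('m \<Rightarrow> 'g) \<Rightarrow> ('m \<Rightarrow> 'g \<Rightarrow> 'm) \<Rightarrow>
     'k monoid \<Rightarrow> ('k \<Rightarrow> 'g) \<Rightarrow> ('k \<Rightarrow> 'g \<Rightarrow> 'k) \<Rightarrow> ('m \<Rightarrow> 'k) \<Rightarrow> bool" where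
  "normal_morphism G M n act M' n' act' \<mu> \<longleftrightarrow>
     \<mu> \<in> hom M M' \<and>
     (\<forall>m\<in>carrier M. n' (\<mu> m) = n m) \<and>
     (\<forall>m\<in>carrier M. \<forall>g\<in>carrier G. \<mu> (act m g) = act' (\<mu> m) g)"


section \<open>The free normal closure\<close>

definition normal_factorization ::
    "'a monoid \<Rightarrow> 'g monoid \<Rightarrow> ('a \<Rightarrow> 'g) \<Rightarrow>
     'm monoid \<Rightarrow> ('a \<Rightarrow> 'm) \<Rightarrow> ('m \<Rightarrow> 'g) \<Rightarrow> ('m \<Rightarrow> 'g \<Rightarrow> 'm) \<Rightarrow> bool" where
  "normal_factorization \<Gamma> G \<phi> M \<psi> n act \<longleftrightarrow>
     normal_map M G n act \<and> \<psi> \<in> hom \<Gamma> M \<and> (\<forall>x\<in>carrier \<Gamma>. n (\<psi> x) = \<phi> x)"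

text \<open>The universal property with respect to the normal maps whose source has elements in the
  type \<open>'u\<close>.  Membership in \<open>extensional\<close> only removes the freedom in the values of a HOL function
  outside the carrier.\<close>

definition universal_over ::
    "'u itself \<Rightarrow> 'a monoid \<Rightarrow> 'g monoid \<Rightarrow>
     'n monoid \<Rightarrow> ('a \<Rightarrow> 'n) \<Rightarrow> ('n \<Rightarrow> 'g) \<Rightarrow> ('n \<Rightarrow> 'g \<Rightarrow> 'n) \<Rightarrow> ('a \<Rightarrow> 'g) \<Rightarrow> bool" where
  "universal_over _ \<Gamma> G N c b act \<phi> \<longleftrightarrow>
     (\<forall>(M :: 'u monoid) \<psi> n a. normal_factorization \<Gamma> G \<phi> M \<psi> n a \<longrightarrow>
        (\<exists>!u. u \<in> extensional (carrier N) \<and> normal_morphism G N b act M n a u \<and>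
              (\<forall>x\<in>carrier \<Gamma>. u (c x) = \<psi> x)))"

text \<open>A definition cannot quantify over all types.  Testing against the two types below is no
  restriction: by \<open>normal_closure_universal\<close> it implies the universal property over every type,
  the reason being that \<open>('a \<times> 'g) list\<close> is large enough to carry a normal closure.\<close>

definition normal_closure ::
    "'a monoid \<Rightarrow> 'g monoid \<Rightarrow> ('a \<Rightarrow> 'g) \<Rightarrow>
     'n monoid \<Rightarrow> ('a \<Rightarrow> 'n) \<Rightarrow> ('n \<Rightarrow> 'g) \<Rightarrow> ('n \<Rightarrow> 'g \<Rightarrow> 'n) \<Rightarrow> bool" where
  "normal_closure \<Gamma> G \<phi> N c b act \<longleftrightarrow>
     normal_factorization \<Gamma> G \<phi> N c b act \<and>
     universal_over TYPE('n) \<Gamma> G N c b act \<phi> \<and>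
     universal_over TYPE(('a \<times> 'g) list) \<Gamma> G N c b act \<phi>"


section \<open>The normal closures tower and its limit\<close>

text \<open>\<open>T i\<close> is $\Gamma_i$, \<open>f i\<close> is $\varphi_i$, \<open>d i\<close> is the normal map $\Gamma_{i+1} \to \Gamma_i$
  and \<open>act i\<close> is the action of $\Gamma_i$ on $\Gamma_{i+1}$, for $i \ge 1$; nothing is said about
  index 0.  All groups of the tower live in one type; \<open>normal_closures_tower_exists\<close> shows that
  every homomorphism has such a tower once \<open>G\<close> is relabelled into a suitable type.\<close>

definition normal_closures_tower ::
    "'a monoid \<Rightarrow> 'g monoid \<Rightarrow> ('a \<Rightarrow> 'g) \<Rightarrow>
     (nat \<Rightarrow> 'g monoid) \<Rightarrow> (nat \<Rightarrow> 'a \<Rightarrow> 'g) \<Rightarrow> (nat \<Rightarrow> 'g \<Rightarrow> 'g) \<Rightarrow>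
     (nat \<Rightarrow> 'g \<Rightarrow> 'g \<Rightarrow> 'g) \<Rightarrow> bool" where
  "normal_closures_tower \<Gamma> G \<phi> T f d act \<longleftrightarrow>
     T 1 = G \<and> f 1 = \<phi> \<and>
     (\<forall>i\<ge>1. normal_closure \<Gamma> (T i) (f i) (T (Suc i)) (f (Suc i)) (d i) (act i))"

definition inverse_limit :: "(nat \<Rightarrow> 'g monoid) \<Rightarrow> (nat \<Rightarrow> 'g \<Rightarrow> 'g) \<Rightarrow> (nat \<Rightarrow> 'g) monoid" where
  "inverse_limit T d =
     (product_group {1..} T)
       \<lparr>carrier := {x \<in> carrier (product_group {1..} T). \<forall>i\<ge>1. d i (x (Suc i)) = x i}\<rparr>"


section \<open>Existence of normal closures\<close>

text \<open>The normal closure is presented by words in symbols \<open>(x, g)\<close>, standing for $c(x)^g$.\<close>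

inductive word_cong :: "'a monoid \<Rightarrow> 'g monoid \<Rightarrow> ('a \<Rightarrow> 'g) \<Rightarrow>
    ('a \<times> 'g) list \<Rightarrow> ('a \<times> 'g) list \<Rightarrow> bool" for \<Gamma> G \<phi> where
  wc_refl: "w \<in> lists (carrier \<Gamma> \<times> carrier G) \<Longrightarrow> word_cong \<Gamma> G \<phi> w w"
| wc_sym: "word_cong \<Gamma> G \<phi> v w \<Longrightarrow> word_cong \<Gamma> G \<phi> w v"
| wc_trans: "\<lbrakk>word_cong \<Gamma> G \<phi> u v; word_cong \<Gamma> G \<phi> v w\<rbrakk> \<Longrightarrow> word_cong \<Gamma> G \<phi> u w"
| wc_app: "\<lbrakk>word_cong \<Gamma> G \<phi> u v; word_cong \<Gamma> G \<phi> u' v'\<rbrakk> \<Longrightarrow> word_cong \<Gamma> G \<phi> (u @ u') (v @ v')"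
| wc_one: "g \<in> carrier G \<Longrightarrow> word_cong \<Gamma> G \<phi> [(\<one>\<^bsub>\<Gamma>\<^esub>, g)] []"
| wc_mult: "\<lbrakk>x \<in> carrier \<Gamma>; y \<in> carrier \<Gamma>; g \<in> carrier G\<rbrakk>
    \<Longrightarrow> word_cong \<Gamma> G \<phi> [(x, g), (y, g)] [(x \<otimes>\<^bsub>\<Gamma>\<^esub> y, g)]"
| wc_peiffer: "\<lbrakk>x \<in> carrier \<Gamma>; y \<in> carrier \<Gamma>; g \<in> carrier G; h \<in> carrier G\<rbrakk>
    \<Longrightarrow> word_cong \<Gamma> G \<phi> [(y, h), (x, g)]
          [(x, g), (y, h \<otimes>\<^bsub>G\<^esub> (inv\<^bsub>G\<^esub> g \<otimes>\<^bsub>G\<^esub> \<phi> x \<otimes>\<^bsub>G\<^esub> g))]"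

definition word_eval :: "('a \<Rightarrow> 'm) \<Rightarrow> 'm monoid \<Rightarrow> ('m \<Rightarrow> 'g \<Rightarrow> 'm) \<Rightarrow> ('a \<times> 'g) list \<Rightarrow> 'm" where
  "word_eval \<psi> M act w = foldr (\<lambda>(x, h) r. act (\<psi> x) h \<otimes>\<^bsub>M\<^esub> r) w \<one>\<^bsub>M\<^esub>"

definition word_shift :: "'g monoid \<Rightarrow> 'g \<Rightarrow> ('a \<times> 'g) list \<Rightarrow> ('a \<times> 'g) list" where
  "word_shift G k w = map (\<lambda>(x, h). (x, h \<otimes>\<^bsub>G\<^esub> k)) w"

definition conj_act :: "'g monoid \<Rightarrow> 'g \<Rightarrow> 'g \<Rightarrow> 'g" where
  "conj_act G m g = inv\<^bsub>G\<^esub> g \<otimes>\<^bsub>G\<^esub> m \<otimes>\<^bsub>G\<^esub> g"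

lemma word_eval_simps [simp]:
  "word_eval \<psi> M act [] = \<one>\<^bsub>M\<^esub>"
  "word_eval \<psi> M act ((x, h) # w) = act (\<psi> x) h \<otimes>\<^bsub>M\<^esub> word_eval \<psi> M act w"
  by (simp_all add: word_eval_def)

lemma word_shift_simps [simp]:
  "word_shift G k [] = []"
  "word_shift G k ((x, h) # w) = (x, h \<otimes>\<^bsub>G\<^esub> k) # word_shift G k w"
  "word_shift G k (u @ v) = word_shift G k u @ word_shift G k v"
  by (simp_all add: word_shift_def)

context normal_map
begin

lemma act_closed [simp]: "\<lbrakk>m \<in> carrier M; g \<in> carrier G\<rbrakk> \<Longrightarrow> act m g \<in> carrier M"
  using act_auto[of g] by (auto simp: iso_def hom_def)

lemma act_hom: "\<lbrakk>m \<in> carrier M; m' \<in> carrier M; g \<in> carrier G\<rbrakk>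
    \<Longrightarrow> act (m \<otimes>\<^bsub>M\<^esub> m') g = act m g \<otimes>\<^bsub>M\<^esub> act m' g"
  using act_auto[of g] by (auto simp: iso_def hom_def)

lemma act_id: "g \<in> carrier G \<Longrightarrow> act \<one>\<^bsub>M\<^esub> g = \<one>\<^bsub>M\<^esub>"
  using act_auto[of g] hom_one[of "\<lambda>m. act m g" M M] M.is_group by (auto simp: iso_def)

lemma n_closed [simp]: "m \<in> carrier M \<Longrightarrow> n m \<in> carrier G"
  using n_hom by (auto simp: hom_def)

lemma peiffer_swap: "\<lbrakk>m \<in> carrier M; m' \<in> carrier M\<rbrakk>
    \<Longrightarrow> m \<otimes>\<^bsub>M\<^esub> m' = m' \<otimes>\<^bsub>M\<^esub> act m (n m')"
  by (simp add: peiffer M.m_assoc flip: M.m_assoc[of m' "inv\<^bsub>M\<^esub> m'"])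

end

lemma normal_map_conj:
  assumes "group G" shows "normal_map G G (\<lambda>x. x) (conj_act G)"
proof -
  interpret group G by fact
  have inv_assoc: "inv\<^bsub>G\<^esub> g \<otimes>\<^bsub>G\<^esub> (g \<otimes>\<^bsub>G\<^esub> y) = y" "g \<otimes>\<^bsub>G\<^esub> (inv\<^bsub>G\<^esub> g \<otimes>\<^bsub>G\<^esub> y) = y"
    if "g \<in> carrier G" "y \<in> carrier G" for g y
    using that by (simp_all flip: m_assoc)
  show ?thesis
  proof unfold_locales
    show "(\<lambda>m. conj_act G m g) \<in> iso G G" if "g \<in> carrier G" for g
    proof (rule isoI)
      show "(\<lambda>m. conj_act G m g) \<in> hom G G"
        using that by (auto simp: hom_def conj_act_def m_assoc inv_assoc)
      show "bij_betw (\<lambda>m. conj_act G m g) (carrier G) (carrier G)"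
        using that
        by (intro bij_betw_byWitness[where f' = "\<lambda>m. conj_act G m (inv\<^bsub>G\<^esub> g)"])
          (auto simp: conj_act_def m_assoc inv_assoc)
    qed
  qed (auto simp: hom_def conj_act_def m_assoc inv_mult_group)
qed

locale free_nc = A: group \<Gamma> + G: group G
  for \<Gamma> :: "'a monoid" and G :: "'g monoid" +
  fixes \<phi> :: "'a \<Rightarrow> 'g" and q :: "('a \<times> 'g) list \<Rightarrow> 'n"
  assumes phi: "\<phi> \<in> hom \<Gamma> G"
    and q_iff: "\<lbrakk>v \<in> lists (carrier \<Gamma> \<times> carrier G); w \<in> lists (carrier \<Gamma> \<times> carrier G)\<rbrakk>
      \<Longrightarrow> q v = q w \<longleftrightarrow> word_cong \<Gamma> G \<phi> v w"
begin

declare in_listsD [rule del] in_listsI [rule del]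

abbreviation "W \<equiv> lists (carrier \<Gamma> \<times> carrier G)"
abbreviation R (infix \<open>\<leadsto>\<close> 50) where "v \<leadsto> w \<equiv> word_cong \<Gamma> G \<phi> v w"
abbreviation "nw \<equiv> word_eval \<phi> G (conj_act G)"
abbreviation "sh \<equiv> word_shift G"

definition "rep m = (SOME w. w \<in> W \<and> q w = m)"
definition "F = \<lparr>carrier = q ` W, monoid.mult = (\<lambda>m m'. q (rep m @ rep m')), one = q []\<rparr>"
definition "c x = q [(x, \<one>\<^bsub>G\<^esub>)]"
definition "b m = nw (rep m)"
definition "a m g = q (sh g (rep m))"

lemma phi_closed [simp]: "x \<in> carrier \<Gamma> \<Longrightarrow> \<phi> x \<in> carrier G"
  using phi by (auto simp: hom_def)

lemma inv_assoc: "\<lbrakk>g \<in> carrier G; y \<in> carrier G\<rbrakk> \<Longrightarrow> inv\<^bsub>G\<^esub> g \<otimes>\<^bsub>G\<^esub> (g \<otimes>\<^bsub>G\<^esub> y) = y"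
  "\<lbrakk>g \<in> carrier G; y \<in> carrier G\<rbrakk> \<Longrightarrow> g \<otimes>\<^bsub>G\<^esub> (inv\<^bsub>G\<^esub> g \<otimes>\<^bsub>G\<^esub> y) = y"
  by (simp_all flip: G.m_assoc)

lemma R_W: "v \<leadsto> w \<Longrightarrow> v \<in> W \<and> w \<in> W"
  by (induction rule: word_cong.induct) auto

lemma rep: "w \<in> W \<Longrightarrow> rep (q w) \<in> W \<and> rep (q w) \<leadsto> w"
  using someI[of "\<lambda>v. v \<in> W \<and> q v = q w" w] q_iff unfolding rep_def by blast

lemma sh_W [simp]: "\<lbrakk>w \<in> W; g \<in> carrier G\<rbrakk> \<Longrightarrow> sh g w \<in> W"
  by (induction w) auto

lemma word_eval_closed:
  assumes "normal_factorization \<Gamma> G \<phi> M \<psi> n act" "w \<in> W"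
  shows "word_eval \<psi> M act w \<in> carrier M"
proof -
  interpret normal_map M G n act using assms by (simp add: normal_factorization_def)
  have "\<psi> x \<in> carrier M" if "x \<in> carrier \<Gamma>" for x
    using assms that by (auto simp: normal_factorization_def hom_def)
  with assms(2) show ?thesis by (induction w) auto
qed

lemma word_eval_append:
  assumes "normal_factorization \<Gamma> G \<phi> M \<psi> n act" "v \<in> W" "w \<in> W"
  shows "word_eval \<psi> M act (v @ w) = word_eval \<psi> M act v \<otimes>\<^bsub>M\<^esub> word_eval \<psi> M act w"
proof -
  interpret normal_map M G n act using assms by (simp add: normal_factorization_def)
  have "\<psi> x \<in> carrier M" if "x \<in> carrier \<Gamma>" for x
    using assms that by (auto simp: normal_factorization_def hom_def)
  with assms(2) show ?thesis
    by (induction v) (use word_eval_closed[OF assms(1)] assms(3) in \<open>auto simp: M.m_assoc\<close>)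
qed

lemma word_eval_cong:
  assumes fac: "normal_factorization \<Gamma> G \<phi> M \<psi> n act" and "v \<leadsto> w"
  shows "word_eval \<psi> M act v = word_eval \<psi> M act w"
proof -
  interpret normal_map M G n act using assms by (simp add: normal_factorization_def)
  have psi: "\<psi> x \<in> carrier M" if "x \<in> carrier \<Gamma>" for x
    using fac that by (auto simp: normal_factorization_def hom_def)
  have hom: "\<psi> \<in> hom \<Gamma> M" using fac by (simp add: normal_factorization_def)
  from \<open>v \<leadsto> w\<close> show ?thesis
  proof (induction rule: word_cong.induct)
    case (wc_app u v u' v')
    then show ?case using R_W by (simp add: word_eval_append[OF fac])
  next
    case (wc_one g)
    have "\<psi> \<one>\<^bsub>\<Gamma>\<^esub> = \<one>\<^bsub>M\<^esub>" using hom_one[OF hom] A.is_group M.is_group by simp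
    with wc_one show ?case by (simp add: act_id)
  next
    case (wc_mult x y g)
    then show ?case using hom by (simp add: psi hom_mult[OF hom] act_hom)
  next
    case (wc_peiffer x y g h)
    have "n (act (\<psi> x) g) = inv\<^bsub>G\<^esub> g \<otimes>\<^bsub>G\<^esub> \<phi> x \<otimes>\<^bsub>G\<^esub> g"
      using fac wc_peiffer by (simp add: equivariant psi normal_factorization_def)
    with wc_peiffer show ?case
      using peiffer_swap[of "act (\<psi> y) h" "act (\<psi> x) g"] by (simp add: psi act_mult)
  qed auto
qed

lemma conj_fac: "normal_factorization \<Gamma> G \<phi> G \<phi> (\<lambda>x. x) (conj_act G)"
  by (simp add: normal_factorization_def normal_map_conj G.is_group phi)

lemmas nw_closed [simp] = word_eval_closed[OF conj_fac]
lemmas nw_append = word_eval_append[OF conj_fac]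
lemmas nw_cong = word_eval_cong[OF conj_fac]

lemma sh_cong:
  assumes "v \<leadsto> w" "k \<in> carrier G"
  shows "sh k v \<leadsto> sh k w"
  using assms
proof (induction rule: word_cong.induct)
  case (wc_peiffer x y g h)
  have "(h \<otimes>\<^bsub>G\<^esub> k) \<otimes>\<^bsub>G\<^esub> (inv\<^bsub>G\<^esub> (g \<otimes>\<^bsub>G\<^esub> k) \<otimes>\<^bsub>G\<^esub> \<phi> x \<otimes>\<^bsub>G\<^esub> (g \<otimes>\<^bsub>G\<^esub> k))
      = h \<otimes>\<^bsub>G\<^esub> (inv\<^bsub>G\<^esub> g \<otimes>\<^bsub>G\<^esub> \<phi> x \<otimes>\<^bsub>G\<^esub> g) \<otimes>\<^bsub>G\<^esub> k"
    using wc_peiffer by (simp add: G.m_assoc G.inv_mult_group inv_assoc)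
  with word_cong.wc_peiffer[of x \<Gamma> y "g \<otimes>\<^bsub>G\<^esub> k" G "h \<otimes>\<^bsub>G\<^esub> k" \<phi>] wc_peiffer
  show ?case by simp
qed (auto intro: word_cong.intros)

lemma sh_one: "w \<in> W \<Longrightarrow> sh \<one>\<^bsub>G\<^esub> w = w"
  by (induction w) auto

lemma sh_mult: "\<lbrakk>w \<in> W; g \<in> carrier G; h \<in> carrier G\<rbrakk> \<Longrightarrow> sh (g \<otimes>\<^bsub>G\<^esub> h) w = sh h (sh g w)"
  by (induction w) (auto simp: G.m_assoc)

lemma nw_shift: "\<lbrakk>w \<in> W; g \<in> carrier G\<rbrakk> \<Longrightarrow> nw (sh g w) = inv\<^bsub>G\<^esub> g \<otimes>\<^bsub>G\<^esub> nw w \<otimes>\<^bsub>G\<^esub> g"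
  by (induction w) (auto simp: conj_act_def G.m_assoc G.inv_mult_group inv_assoc)

lemma R_Cons: "\<lbrakk>v \<leadsto> w; p \<in> carrier \<Gamma> \<times> carrier G\<rbrakk> \<Longrightarrow> p # v \<leadsto> p # w"
  using wc_app[of \<Gamma> G \<phi> "[p]" "[p]" v w] wc_refl[of "[p]" \<Gamma> G \<phi>] by simp

lemma R_inverse: "w \<in> W \<Longrightarrow> \<exists>v\<in>W. v @ w \<leadsto> []"
proof (induction w)
  case Nil
  then show ?case by (auto intro!: bexI[of _ "[]"] wc_refl)
next
  case (Cons p w)
  obtain x g where p: "p = (x, g)" "x \<in> carrier \<Gamma>" "g \<in> carrier G" using Cons by auto
  obtain v where v: "v \<in> W" "v @ w \<leadsto> []" using Cons by auto
  have "[(inv\<^bsub>\<Gamma>\<^esub> x, g), (x, g)] \<leadsto> []"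
    using wc_trans[OF wc_mult[of "inv\<^bsub>\<Gamma>\<^esub> x" \<Gamma> x g G \<phi>]] wc_one[of g G \<Gamma> \<phi>] p by simp
  then have "v @ ([(inv\<^bsub>\<Gamma>\<^esub> x, g), (x, g)] @ w) \<leadsto> v @ ([] @ w)"
    using v Cons by (intro wc_app wc_refl) auto
  with v have "(v @ [(inv\<^bsub>\<Gamma>\<^esub> x, g)]) @ p # w \<leadsto> []"
    using wc_trans p by fastforce
  with v p show ?case by (intro bexI[of _ "v @ [(inv\<^bsub>\<Gamma>\<^esub> x, g)]"]) auto
qed

lemma R_peiffer1: "\<lbrakk>w \<in> W; y \<in> carrier \<Gamma>; h \<in> carrier G\<rbrakk>
    \<Longrightarrow> (y, h) # w \<leadsto> w @ [(y, h \<otimes>\<^bsub>G\<^esub> nw w)]"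
proof (induction w arbitrary: h)
  case Nil
  then show ?case by (auto intro: wc_refl)
next
  case (Cons p w)
  obtain x g where p: "p = (x, g)" "x \<in> carrier \<Gamma>" "g \<in> carrier G" using Cons by auto
  define h' where "h' = h \<otimes>\<^bsub>G\<^esub> (inv\<^bsub>G\<^esub> g \<otimes>\<^bsub>G\<^esub> \<phi> x \<otimes>\<^bsub>G\<^esub> g)"
  have h': "h' \<in> carrier G" using p Cons by (simp add: h'_def)
  have "[(y, h), (x, g)] @ w \<leadsto> [(x, g), (y, h')] @ w"
    unfolding h'_def using Cons p by (intro wc_app wc_refl wc_peiffer) auto
  moreover have "(x, g) # (y, h') # w \<leadsto> (x, g) # w @ [(y, h' \<otimes>\<^bsub>G\<^esub> nw w)]"
    using Cons p h' by (intro R_Cons) auto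
  moreover have "h' \<otimes>\<^bsub>G\<^esub> nw w = h \<otimes>\<^bsub>G\<^esub> nw (p # w)"
    using Cons p by (simp add: h'_def conj_act_def G.m_assoc)
  ultimately show ?case using wc_trans p by fastforce
qed

lemma R_peiffer: "\<lbrakk>v \<in> W; w \<in> W\<rbrakk> \<Longrightarrow> v @ w \<leadsto> w @ sh (nw w) v"
proof (induction v)
  case Nil
  then show ?case by (auto intro: wc_refl)
next
  case (Cons p v)
  obtain y h where p: "p = (y, h)" "y \<in> carrier \<Gamma>" "h \<in> carrier G" using Cons by auto
  have "p # v @ w \<leadsto> p # w @ sh (nw w) v"
    using Cons p by (intro R_Cons) auto
  moreover have "((y, h) # w) @ sh (nw w) v \<leadsto> (w @ [(y, h \<otimes>\<^bsub>G\<^esub> nw w)]) @ sh (nw w) v"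
    using Cons p by (intro wc_app R_peiffer1 wc_refl) auto
  ultimately show ?case using wc_trans p by fastforce
qed

lemma F_simps:
  "carrier F = q ` W"
  "one F = q []"
  "\<lbrakk>v \<in> W; w \<in> W\<rbrakk> \<Longrightarrow> q v \<otimes>\<^bsub>F\<^esub> q w = q (v @ w)"
  using rep by (auto simp: F_def q_iff intro: wc_app)

lemma b_q: "w \<in> W \<Longrightarrow> b (q w) = nw w"
  using rep nw_cong by (simp add: b_def)

lemma a_q: "\<lbrakk>w \<in> W; g \<in> carrier G\<rbrakk> \<Longrightarrow> a (q w) g = q (sh g w)"
  using rep by (simp add: a_def q_iff sh_cong)

lemma group_F: "group F"
proof (rule groupI)
  show "\<exists>y\<in>carrier F. y \<otimes>\<^bsub>F\<^esub> x = \<one>\<^bsub>F\<^esub>" if "x \<in> carrier F" for x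
  proof -
    obtain w where w: "w \<in> W" "x = q w" using \<open>x \<in> carrier F\<close> by (auto simp: F_simps)
    obtain v where v: "v \<in> W" "v @ w \<leadsto> []" using R_inverse w by blast
    then have "q v \<otimes>\<^bsub>F\<^esub> x = \<one>\<^bsub>F\<^esub>" using w R_W by (simp add: F_simps q_iff)
    with v show ?thesis by (auto simp: F_simps)
  qed
qed (auto simp: F_simps)

lemma normal_map_F: "normal_map F G b a"
proof -
  interpret F: group F by (rule group_F)
  have aone: "a m \<one>\<^bsub>G\<^esub> = m" if "m \<in> carrier F" for m
    using that by (auto simp: F_simps a_q sh_one)
  have amult: "a m (g \<otimes>\<^bsub>G\<^esub> h) = a (a m g) h"
    if "m \<in> carrier F" "g \<in> carrier G" "h \<in> carrier G" for m g h
    using that by (auto simp: F_simps a_q sh_mult)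
  have aclosed: "a m g \<in> carrier F" if "m \<in> carrier F" "g \<in> carrier G" for m g
    using that by (auto simp: F_simps a_q)
  show ?thesis
  proof unfold_locales
    show "b \<in> hom F G"
      by (auto simp: hom_def F_simps b_q nw_append)
    show "(\<lambda>m. a m g) \<in> iso F F" if g: "g \<in> carrier G" for g
    proof (rule isoI)
      show "(\<lambda>m. a m g) \<in> hom F F"
        using g by (auto simp: hom_def F_simps a_q)
      have "a (a m g) (inv\<^bsub>G\<^esub> g) = m" "a (a m (inv\<^bsub>G\<^esub> g)) g = m" if "m \<in> carrier F" for m
        using amult[of m g "inv\<^bsub>G\<^esub> g"] amult[of m "inv\<^bsub>G\<^esub> g" g] aone that g by simp_all
      then show "bij_betw (\<lambda>m. a m g) (carrier F) (carrier F)"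
        using g aclosed
        by (intro bij_betw_byWitness[where f' = "\<lambda>m. a m (inv\<^bsub>G\<^esub> g)"]) auto
    qed
    show "b (a m g) = inv\<^bsub>G\<^esub> g \<otimes>\<^bsub>G\<^esub> b m \<otimes>\<^bsub>G\<^esub> g" if "m \<in> carrier F" "g \<in> carrier G" for m g
      using that by (auto simp: F_simps a_q b_q nw_shift)
    show "a m (b m') = inv\<^bsub>F\<^esub> m' \<otimes>\<^bsub>F\<^esub> m \<otimes>\<^bsub>F\<^esub> m'"
      if m: "m \<in> carrier F" "m' \<in> carrier F" for m m'
    proof -
      obtain v w where vw: "v \<in> W" "w \<in> W" "m = q v" "m' = q w" using m by (auto simp: F_simps)
      have "m \<otimes>\<^bsub>F\<^esub> m' = m' \<otimes>\<^bsub>F\<^esub> a m (b m')"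
        using vw R_peiffer[of v w] R_W by (simp add: F_simps a_q b_q q_iff)
      moreover have "a m (b m') \<in> carrier F"
        using vw aclosed m by (simp add: b_q)
      ultimately show ?thesis
        using m by (simp add: F.m_assoc flip: F.m_assoc[of "inv\<^bsub>F\<^esub> m'" m'])
    qed
  qed (use aone amult in auto)
qed

lemma factorization_F: "normal_factorization \<Gamma> G \<phi> F c b a"
  unfolding normal_factorization_def
proof (intro conjI ballI normal_map_F)
  show "c \<in> hom \<Gamma> F"
    by (auto simp: hom_def c_def F_simps q_iff intro: wc_mult wc_sym)
  show "b (c x) = \<phi> x" if "x \<in> carrier \<Gamma>" for x
    using that by (simp add: c_def b_q conj_act_def)
qed

lemma universal_F: "universal_over TYPE('u) \<Gamma> G F c b a \<phi>"
  unfolding universal_over_def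
proof (intro allI impI)
  fix M :: "'u monoid" and \<psi> n act
  assume fac: "normal_factorization \<Gamma> G \<phi> M \<psi> n act"
  interpret normal_map M G n act using fac by (simp add: normal_factorization_def)
  interpret F: normal_map F G b a by (rule normal_map_F)
  have psi: "\<psi> x \<in> carrier M" "n (\<psi> x) = \<phi> x" if "x \<in> carrier \<Gamma>" for x
    using fac that by (auto simp: normal_factorization_def hom_def)
  note ev = word_eval_closed[OF fac]
  define e where "e = word_eval \<psi> M act"
  have e_closed: "e w \<in> carrier M" if "w \<in> W" for w
    using ev that by (simp add: e_def)
  have e_Cons: "e ((x, g) # w) = act (\<psi> x) g \<otimes>\<^bsub>M\<^esub> e w" for x g w
    by (simp add: e_def)
  have e_append: "e (v @ w) = e v \<otimes>\<^bsub>M\<^esub> e w" if "v \<in> W" "w \<in> W" for v w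
    using word_eval_append[OF fac] that by (simp add: e_def)
  define u where "u = (\<lambda>m\<in>carrier F. e (rep m))"
  have u_q: "u (q w) = e w" if "w \<in> W" for w
    using that rep word_eval_cong[OF fac] by (auto simp: u_def e_def F_simps)
  have n_e: "n (e w) = nw w" if "w \<in> W" for w
    using that
  proof (induction w)
    case Nil
    then show ?case using hom_one[OF n_hom M.is_group G.is_group] by (simp add: e_def)
  next
    case (Cons p w)
    obtain x g where p: "p = (x, g)" "x \<in> carrier \<Gamma>" "g \<in> carrier G" using Cons by auto
    have "n (act (\<psi> x) g \<otimes>\<^bsub>M\<^esub> e w) = n (act (\<psi> x) g) \<otimes>\<^bsub>G\<^esub> n (e w)"
      using hom_mult[OF n_hom] e_closed psi p Cons by simp
    then show ?case
      using Cons p by (simp add: e_Cons conj_act_def equivariant psi)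
  qed
  have e_sh: "e (sh g w) = act (e w) g" if "w \<in> W" "g \<in> carrier G" for w g
    using that
  proof (induction w)
    case Nil
    then show ?case by (simp add: e_def act_id)
  next
    case (Cons p w)
    then show ?case by (cases p) (simp add: e_Cons e_closed psi act_hom act_mult)
  qed
  have "normal_morphism G F b a M n act u"
    unfolding normal_morphism_def
  proof (intro conjI ballI)
    show "u \<in> hom F M"
      by (auto simp: hom_def F_simps u_q e_closed e_append)
  qed (auto simp: F_simps u_q b_q a_q n_e e_sh)
  moreover have "u (c x) = \<psi> x" if "x \<in> carrier \<Gamma>" for x
    using that psi by (simp add: c_def u_q) (simp add: e_def act_one)
  moreover have "u' = u"
    if u': "u' \<in> extensional (carrier F)" "normal_morphism G F b a M n act u'"
      "\<forall>x\<in>carrier \<Gamma>. u' (c x) = \<psi> x" for u'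
  proof -
    have hom: "u' \<in> hom F M" using u'(2) unfolding normal_morphism_def by (rule conjunct1)
    have "u' (q w) = e w" if "w \<in> W" for w
      using that
    proof (induction w)
      case Nil
      then show ?case
        using hom_one[OF hom F.M.is_group M.is_group] by (simp add: e_def F_simps)
    next
      case (Cons p w)
      obtain x g where p: "p = (x, g)" "x \<in> carrier \<Gamma>" "g \<in> carrier G" using Cons by auto
      have 1: "q (p # w) = q [p] \<otimes>\<^bsub>F\<^esub> q w" "q [p] = a (c x) g"
        using Cons p by (simp_all add: F_simps a_q c_def)
      have "c x \<in> carrier F" "q [p] \<in> carrier F" "q w \<in> carrier F"
        using Cons p by (auto simp: F_simps c_def)
      then have "u' (q [p] \<otimes>\<^bsub>F\<^esub> q w) = u' (q [p]) \<otimes>\<^bsub>M\<^esub> u' (q w)"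
        by (intro hom_mult[OF hom])
      then have "u' (q (p # w)) = u' (a (c x) g) \<otimes>\<^bsub>M\<^esub> u' (q w)"
        by (simp only: 1)
      also have "u' (a (c x) g) = act (\<psi> x) g"
        using u'(2,3) p \<open>c x \<in> carrier F\<close> by (simp add: normal_morphism_def)
      finally show ?case using Cons p by (simp add: e_Cons)
    qed
    then have "u' m = u m" if "m \<in> carrier F" for m
      using that u_q by (fastforce simp: F_simps(1))
    with u'(1) show ?thesis
      by (intro extensionalityI[of _ "carrier F"]) (simp_all add: u_def)
  qed
  ultimately show "\<exists>!u. u \<in> extensional (carrier F) \<and> normal_morphism G F b a M n act u \<and>
      (\<forall>x\<in>carrier \<Gamma>. u (c x) = \<psi> x)"
    by (intro ex1I[of _ u]) (auto simp: u_def)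
qed

lemma normal_closure_F: "normal_closure \<Gamma> G \<phi> F c b a"
  by (simp add: normal_closure_def factorization_F universal_F)

end

lemma normal_morphism_restrict:
  assumes "normal_map N G b a" "normal_morphism G N b a M n act u"
  shows "normal_morphism G N b a M n act (restrict u (carrier N))"
proof -
  interpret normal_map N G b a by fact
  show ?thesis using assms(2) by (auto simp: normal_morphism_def hom_def)
qed

lemma normal_morphism_comp:
  assumes "normal_map N G b a"
    and u: "normal_morphism G N b a M n act u" and v: "normal_morphism G M n act K k act' v"
  shows "normal_morphism G N b a K k act' (v \<circ> u)"
proof -
  interpret normal_map N G b a by fact
  have "u x \<in> carrier M" if "x \<in> carrier N" for x
    using u that by (auto simp: normal_morphism_def hom_def)
  with u v show ?thesis by (auto simp: normal_morphism_def hom_def)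
qed

lemma universal_over_unique:
  fixes M :: "'u monoid"
  assumes univ: "universal_over TYPE('u) \<Gamma> G N c b a \<phi>"
    and N: "normal_factorization \<Gamma> G \<phi> N c b a" and M: "normal_map M G n act"
    and p: "normal_morphism G N b a M n act p" and q: "normal_morphism G N b a M n act q"
    and eq: "\<And>x. x \<in> carrier \<Gamma> \<Longrightarrow> p (c x) = q (c x)"
    and m: "m \<in> carrier N"
  shows "p m = q m"
proof -
  have nm: "normal_map N G b a" and c: "c \<in> hom \<Gamma> N" and bc: "\<forall>x\<in>carrier \<Gamma>. b (c x) = \<phi> x"
    using N by (auto simp: normal_factorization_def)
  have cc: "c x \<in> carrier N" if "x \<in> carrier \<Gamma>" for x using c that by (auto simp: hom_def)
  have "normal_factorization \<Gamma> G \<phi> M (p \<circ> c) n act"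
    using M p c bc cc by (auto simp: normal_factorization_def normal_morphism_def hom_def)
  then have ex1: "\<exists>!u. u \<in> extensional (carrier N) \<and> normal_morphism G N b a M n act u \<and>
      (\<forall>x\<in>carrier \<Gamma>. u (c x) = (p \<circ> c) x)"
    using univ unfolding universal_over_def by blast
  have "restrict p (carrier N) = restrict q (carrier N)"
    using normal_morphism_restrict[OF nm p] normal_morphism_restrict[OF nm q] eq cc
    by (intro trans[OF the1_equality[OF ex1, symmetric] the1_equality[OF ex1]]) auto
  then show ?thesis using m by (metis restrict_apply')
qed

lemma universal_over_ex:
  fixes M :: "'u monoid"
  assumes "universal_over TYPE('u) \<Gamma> G N c b a \<phi>" "normal_factorization \<Gamma> G \<phi> M \<psi> n act"
  obtains u where "normal_morphism G N b a M n act u" "\<And>x. x \<in> carrier \<Gamma> \<Longrightarrow> u (c x) = \<psi> x"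
  using assms unfolding universal_over_def by blast

lemma free_nc_exists:
  fixes \<Gamma> :: "'a monoid" and G :: "'g monoid"
  assumes "group \<Gamma>" "group G" "\<phi> \<in> hom \<Gamma> G" and j: "inj (j :: ('a \<times> 'g) list \<Rightarrow> 'n)"
  shows "\<exists>q :: ('a \<times> 'g) list \<Rightarrow> 'n. free_nc \<Gamma> G \<phi> q"
proof (intro exI)
  let ?R = "word_cong \<Gamma> G \<phi>"
  have "(SOME u. ?R v u) = (SOME u. ?R w u) \<longleftrightarrow> ?R v w"
    if "v \<in> lists (carrier \<Gamma> \<times> carrier G)" "w \<in> lists (carrier \<Gamma> \<times> carrier G)" for v w
  proof
    have "?R v (SOME u. ?R v u)" "?R w (SOME u. ?R w u)"
      using that by (metis someI wc_refl)+
    then show "?R v w" if "(SOME u. ?R v u) = (SOME u. ?R w u)"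
      using that by (metis wc_sym wc_trans)
    have "?R v = ?R w" if "?R v w"
      using that by (blast intro: wc_sym wc_trans)
    then show "(SOME u. ?R v u) = (SOME u. ?R w u)" if "?R v w"
      using that by simp
  qed
  then show "free_nc \<Gamma> G \<phi> (\<lambda>w. j (SOME u. ?R w u))"
    using assms by (simp add: free_nc_def free_nc_axioms_def inj_eq)
qed

theorem normal_closure_exists:
  fixes \<Gamma> :: "'a monoid" and G :: "'g monoid"
  assumes "group \<Gamma>" "group G" "\<phi> \<in> hom \<Gamma> G" "inj (j :: ('a \<times> 'g) list \<Rightarrow> 'n)"
  shows "\<exists>(N :: 'n monoid) c b a. normal_closure \<Gamma> G \<phi> N c b a"
  using free_nc_exists[OF assms] free_nc.normal_closure_F by blast

theorem normal_closure_universal: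
  fixes \<Gamma> :: "'a monoid" and G :: "'g monoid" and N :: "'n monoid"
  assumes "group \<Gamma>" "normal_closure \<Gamma> G \<phi> N c b a"
  shows "universal_over TYPE('u) \<Gamma> G N c b a \<phi>"
  unfolding universal_over_def
proof (intro allI impI)
  fix M :: "'u monoid" and \<psi> n act
  assume M: "normal_factorization \<Gamma> G \<phi> M \<psi> n act"
  have N: "normal_factorization \<Gamma> G \<phi> N c b a"
    and univ: "universal_over TYPE('n) \<Gamma> G N c b a \<phi>"
      "universal_over TYPE(('a \<times> 'g) list) \<Gamma> G N c b a \<phi>"
    using assms(2) by (auto simp: normal_closure_def)
  interpret N: normal_map N G b a using N by (simp add: normal_factorization_def)
  have c: "c x \<in> carrier N" if "x \<in> carrier \<Gamma>" for x
    using N that by (auto simp: normal_factorization_def hom_def)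
  have bc: "b (c x) = \<phi> x" if "x \<in> carrier \<Gamma>" for x
    using N that by (simp add: normal_factorization_def)
  have "\<phi> \<in> hom \<Gamma> G"
  proof (rule homI)
    fix x y assume xy: "x \<in> carrier \<Gamma>" "y \<in> carrier \<Gamma>"
    have "\<phi> (x \<otimes>\<^bsub>\<Gamma>\<^esub> y) = b (c (x \<otimes>\<^bsub>\<Gamma>\<^esub> y))"
      using xy bc assms(1) by (simp add: group.is_monoid monoid.m_closed)
    also have "\<dots> = b (c x \<otimes>\<^bsub>N\<^esub> c y)"
      using hom_mult[of c \<Gamma> N x y] N xy by (simp add: normal_factorization_def)
    also have "\<dots> = b (c x) \<otimes>\<^bsub>G\<^esub> b (c y)"
      using c xy by (intro hom_mult[OF N.n_hom])
    finally show "\<phi> (x \<otimes>\<^bsub>\<Gamma>\<^esub> y) = \<phi> x \<otimes>\<^bsub>G\<^esub> \<phi> y"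
      using bc xy by simp
  next
    show "\<phi> x \<in> carrier G" if "x \<in> carrier \<Gamma>" for x
      using N.n_closed[OF c[OF that]] bc[OF that] by simp
  qed
  then obtain q :: "('a \<times> 'g) list \<Rightarrow> ('a \<times> 'g) list" where "free_nc \<Gamma> G \<phi> q"
    using free_nc_exists[OF assms(1) N.G.is_group _ inj_on_id] by blast
  then interpret F: free_nc \<Gamma> G \<phi> q .
  obtain u where u: "normal_morphism G N b a F.F F.b F.a u" "\<And>x. x \<in> carrier \<Gamma> \<Longrightarrow> u (c x) = F.c x"
    using universal_over_ex[OF univ(2) F.factorization_F] by blast
  obtain v where v: "normal_morphism G F.F F.b F.a N b a v" "\<And>x. x \<in> carrier \<Gamma> \<Longrightarrow> v (F.c x) = c x"
    using universal_over_ex[OF F.universal_F N] by blast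
  obtain w where w: "normal_morphism G F.F F.b F.a M n act w" "\<And>x. x \<in> carrier \<Gamma> \<Longrightarrow> w (F.c x) = \<psi> x"
    using universal_over_ex[OF F.universal_F M] by blast
  have idN: "normal_morphism G N b a N b a (\<lambda>x. x)"
    by (simp add: normal_morphism_def hom_def)
  have vu: "v (u m) = m" if "m \<in> carrier N" for m
    using universal_over_unique[OF univ(1) N N.normal_map_axioms
        normal_morphism_comp[OF N.normal_map_axioms u(1) v(1)] idN _ that] u v by simp
  have uF: "u m \<in> carrier F.F" if "m \<in> carrier N" for m
    using u that by (auto simp: normal_morphism_def hom_def)
  have nM: "normal_map M G n act" using M by (simp add: normal_factorization_def)
  show "\<exists>!p. p \<in> extensional (carrier N) \<and> normal_morphism G N b a M n act p \<and>
      (\<forall>x\<in>carrier \<Gamma>. p (c x) = \<psi> x)"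
  proof (rule ex_ex1I)
    show "\<exists>p. p \<in> extensional (carrier N) \<and> normal_morphism G N b a M n act p \<and>
        (\<forall>x\<in>carrier \<Gamma>. p (c x) = \<psi> x)"
      using normal_morphism_restrict[OF N.normal_map_axioms
          normal_morphism_comp[OF N.normal_map_axioms u(1) w(1)]] u w c
      by (intro exI[of _ "restrict (w \<circ> u) (carrier N)"]) auto
  next
    fix p p'
    assume p: "p \<in> extensional (carrier N) \<and> normal_morphism G N b a M n act p \<and>
        (\<forall>x\<in>carrier \<Gamma>. p (c x) = \<psi> x)"
      and p': "p' \<in> extensional (carrier N) \<and> normal_morphism G N b a M n act p' \<and>
        (\<forall>x\<in>carrier \<Gamma>. p' (c x) = \<psi> x)"
    have "p (v m) = p' (v m)" if "m \<in> carrier F.F" for m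
      using universal_over_unique[OF F.universal_F F.factorization_F nM
          normal_morphism_comp[OF F.normal_map_F v(1)] normal_morphism_comp[OF F.normal_map_F v(1)] _ that,
          of p p'] p p' v by simp
    then show "p = p'"
      using p p' vu uF by (intro extensionalityI[of p "carrier N" p']) (auto, metis)
  qed
qed

text \<open>A type that carries a tower over a relabelled copy of any \<open>G :: 'g monoid\<close>.\<close>

datatype ('a, 'g) tower_elem = Base 'g | Word "('a \<times> ('a, 'g) tower_elem) list"

theorem normal_closures_tower_exists:
  fixes \<Gamma> :: "'a monoid" and G :: "'g monoid"
  assumes "group \<Gamma>" "group G" "\<phi> \<in> hom \<Gamma> G"
  shows "\<exists>(G' :: ('a, 'g) tower_elem monoid) T f d act.
    Base \<in> iso G G' \<and> normal_closures_tower \<Gamma> G' (Base \<circ> \<phi>) T f d act"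
proof -
  interpret G: group G by fact
  define G' :: "('a, 'g) tower_elem monoid" where
    "G' = \<lparr>carrier = Base ` carrier G,
      monoid.mult = (\<lambda>x y. Base (the_inv Base x \<otimes>\<^bsub>G\<^esub> the_inv Base y)), one = Base \<one>\<^bsub>G\<^esub>\<rparr>"
  have inj: "inj (Base :: 'g \<Rightarrow> ('a, 'g) tower_elem)" by (simp add: inj_def)
  have simps: "carrier G' = Base ` carrier G" "\<one>\<^bsub>G'\<^esub> = Base \<one>\<^bsub>G\<^esub>"
    "Base x \<otimes>\<^bsub>G'\<^esub> Base y = Base (x \<otimes>\<^bsub>G\<^esub> y)" for x y
    by (simp_all add: G'_def the_inv_f_f[OF inj])
  have iso: "Base \<in> iso G G'"
    by (auto simp: iso_def hom_def simps bij_betw_def inj_on_def)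
  have "group G'"
    by (rule groupI) (auto simp: simps G.m_assoc intro!: G.l_inv bexI[of _ "inv\<^bsub>G\<^esub> _"])
  have hom0: "Base \<circ> \<phi> \<in> hom \<Gamma> G'"
    using assms(3) by (auto simp: hom_def simps)
  define P where "P = (\<lambda>(N :: ('a, 'g) tower_elem monoid, c, b :: ('a, 'g) tower_elem \<Rightarrow> ('a, 'g) tower_elem,
      a :: ('a, 'g) tower_elem \<Rightarrow> ('a, 'g) tower_elem \<Rightarrow> ('a, 'g) tower_elem). group N \<and> c \<in> hom \<Gamma> N)"
  define S where "S = (\<lambda>(H :: ('a, 'g) tower_elem monoid, \<psi>, b0 :: ('a, 'g) tower_elem \<Rightarrow> ('a, 'g) tower_elem,
      a0 :: ('a, 'g) tower_elem \<Rightarrow> ('a, 'g) tower_elem \<Rightarrow> ('a, 'g) tower_elem). \<lambda>(N :: ('a, 'g) tower_elem monoid, c, b, a). normal_closure \<Gamma> H \<psi> N c b a)"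
  have step: "\<exists>y. P y \<and> S x y" if "P x" for x
  proof -
    obtain H \<psi> b0 a0 where x: "x = (H, \<psi>, b0, a0)" by (cases x)
    then have H: "group H" "\<psi> \<in> hom \<Gamma> H" using that by (auto simp: P_def)
    obtain N :: "('a, 'g) tower_elem monoid" and c b a where N: "normal_closure \<Gamma> H \<psi> N c b a"
      using normal_closure_exists[OF assms(1) H, of Word] by (auto simp: inj_def)
    then have "group N" "c \<in> hom \<Gamma> N"
      by (auto simp: normal_closure_def normal_factorization_def normal_map_def)
    with N show ?thesis by (auto simp: x P_def S_def)
  qed
  have "P (G', Base \<circ> \<phi>, undefined, undefined)"
    using \<open>group G'\<close> hom0 by (simp add: P_def)
  then obtain Y where Y: "Y 0 = (G', Base \<circ> \<phi>, undefined, undefined)" "\<And>i. S (Y i) (Y (Suc i))"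
    using dependent_nat_choice[of "\<lambda>i x. P x \<and> (i = 0 \<longrightarrow> x = (G', Base \<circ> \<phi>, undefined, undefined))"
        "\<lambda>_. S"] step by (metis Zero_not_Suc)
  define T where "T i = fst (Y (i - 1))" for i
  define f where "f i = fst (snd (Y (i - 1)))" for i
  define d where "d i = fst (snd (snd (Y i)))" for i
  define act where "act i = snd (snd (snd (Y i)))" for i
  have "normal_closure \<Gamma> (T i) (f i) (T (Suc i)) (f (Suc i)) (d i) (act i)" if "i \<ge> 1" for i
    using Y(2)[of "i - 1"] that
    by (simp add: T_def f_def d_def act_def S_def case_prod_beta)
  then have "normal_closures_tower \<Gamma> G' (Base \<circ> \<phi>) T f d act"
    by (simp add: normal_closures_tower_def T_def f_def Y(1))
  with iso show ?thesis by blast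
qed

end

theory Submission
  imports Defs "HOL-Number_Theory.Cong"
begin

text \<open>The tower stops growing on the part that the limit sees.  Let \<open>S\<^sub>i\<close> be the image of \<open>T (i + k)\<close> in \<open>T i\<close>
  for a \<open>k\<close> such that \<open>k + 1\<close> gives the same image; there is one because every \<open>T i\<close> is finite.  It
  contains the \<open>i\<close>-th components of all elements of the inverse limit.  If the orders of the groups
  \<open>S\<^sub>i\<close> stay below one bound, then so does the number of elements of the limit, because finitely many distinct elements of the limit
  are still distinct in some component.

  Three facts about \<open>S\<^sub>i\<close> give the bound.  Its map to \<open>T 1\<close> is a composite of
  homomorphisms with central kernels, as the kernel of a normal map is central.  It contains the
  image \<open>A\<close> of \<open>\<Gamma>\<close>, of order at most that of \<open>\<Gamma>\<close>.  And no proper normal subgroup of it contains \<open>A\<close>: a free normal closure is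
  generated by the elements \<open>c(x)\<^sup>g\<close>, so the image of \<open>T (i + k + 1)\<close> in \<open>T i\<close> is the normal closure of
  \<open>A\<close> in the image of \<open>T (i + k)\<close>, and these two images are equal.

  It remains to bound a finite group \<open>S\<close> in terms of \<open>|A|\<close> and \<open>|Q|\<close> alone, when \<open>A\<close> is a subgroup of \<open>S\<close>
  whose normal closure is \<open>S\<close> and \<open>\<kappa> : S \<rightarrow> Q\<close> is such a composite, with kernel \<open>K\<close>
  (\<open>card_carrier_le\<close>).  What is used of \<open>K\<close> is that its elements commute with the elements of \<open>S\<close>
  of coprime order.  The tool is Dietzmann's lemma: a set of \<open>n\<close> elements that contains
  the unit and is closed under conjugation, inversion and squaring generates at most \<open>n\<^sup>n\<close> elements.
  By this lemma (which also shows that all \<open>T i\<close> are finite) it suffices to bound the number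
  of conjugates of an element \<open>h\<close> of \<open>A\<close> of \<open>p\<close>-power order, for each prime \<open>p\<close>.

  Fix \<open>p\<close>, let \<open>R\<close> be generated by the elements of \<open>S\<close> of order prime to \<open>p\<close>, and let \<open>D\<close> consist of the
  elements of \<open>K\<close> that commute with all elements of \<open>p\<close>-power order.  As \<open>D\<close> centralizes \<open>h\<close>, the index
  of \<open>D\<close> bounds the number of conjugates of \<open>h\<close>.  Modulo \<open>D\<close>, an element of order
  prime to \<open>p\<close> is determined by its image in \<open>Q\<close> (\<open>coprime_order_determined_by_image\<close>), so that
  Dietzmann's lemma bounds \<open>|RD/D|\<close> by \<open>n\<^sup>n\<close> with \<open>n = |Q|\<close>.  Finally \<open>S = R A\<close>, because \<open>S/R\<close> is a \<open>p\<close>-group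
  and a proper subgroup of a \<open>p\<close>-group lies in a proper normal subgroup
  (\<open>normal_proper_supergroup\<close>).  So \<open>D\<close> has index at most \<open>n\<^sup>n |A|\<close>.\<close>

section \<open>Dietzmann's lemma\<close>

lemma nat_self_power_mono: "\<lbrakk>0 < m; m \<le> n\<rbrakk> \<Longrightarrow> m ^ m \<le> n ^ n" for m n :: nat
  using power_increasing[of m n n] power_mono[of m n m] by linarith

lemma card_image_le_by_fibres:
  assumes "finite (h ` A)" "\<And>x y. \<lbrakk>x \<in> A; y \<in> A; h x = h y\<rbrakk> \<Longrightarrow> f x = f y"
  shows "finite (f ` A) \<and> card (f ` A) \<le> card (h ` A)"
proof -
  have "f ` A \<subseteq> (\<lambda>c. f (inv_into A h c)) ` (h ` A)"
  proof
    fix z assume "z \<in> f ` A"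
    then obtain x where x: "x \<in> A" "z = f x" by blast
    then have "f (inv_into A h (h x)) = f x"
      by (intro assms(2) inv_into_into f_inv_into_f) auto
    with x show "z \<in> (\<lambda>c. f (inv_into A h c)) ` (h ` A)" by force
  qed
  then show ?thesis using assms(1) surj_card_le[of "h ` A" "f ` A"] finite_subset by blast
qed

context group
begin

definition list_mult :: "'a list \<Rightarrow> 'a" where
  "list_mult xs = foldr (\<otimes>) xs \<one>"

lemma list_mult_simps [simp]:
  "list_mult [] = \<one>" "list_mult (x # xs) = x \<otimes> list_mult xs"
  by (simp_all add: list_mult_def)

lemma list_mult_closed: "set xs \<subseteq> carrier G \<Longrightarrow> list_mult xs \<in> carrier G"
  by (induction xs) auto

lemma list_mult_append:
  "\<lbrakk>set xs \<subseteq> carrier G; set ys \<subseteq> carrier G\<rbrakk>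
    \<Longrightarrow> list_mult (xs @ ys) = list_mult xs \<otimes> list_mult ys"
  by (induction xs) (auto simp: m_assoc list_mult_closed)

lemma list_mult_replicate_one: "list_mult (replicate n \<one>) = \<one>"
  by (induction n) auto

lemma inv_mult_cancel:
  "\<lbrakk>g \<in> carrier G; y \<in> carrier G\<rbrakk> \<Longrightarrow> inv g \<otimes> (g \<otimes> y) = y"
  "\<lbrakk>g \<in> carrier G; y \<in> carrier G\<rbrakk> \<Longrightarrow> g \<otimes> (inv g \<otimes> y) = y"
  by (simp_all flip: m_assoc)

definition conjugate :: "'a \<Rightarrow> 'a \<Rightarrow> 'a" where
  "conjugate x g = inv g \<otimes> x \<otimes> g"

lemma conjugate_closed [simp]: "\<lbrakk>x \<in> carrier G; g \<in> carrier G\<rbrakk> \<Longrightarrow> conjugate x g \<in> carrier G"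
  by (simp add: conjugate_def)

lemma conjugate_one [simp]: "x \<in> carrier G \<Longrightarrow> conjugate x \<one> = x"
  by (simp add: conjugate_def)

lemma conjugate_one_left [simp]: "g \<in> carrier G \<Longrightarrow> conjugate \<one> g = \<one>"
  by (simp add: conjugate_def)

lemma conjugate_mult:
  "\<lbrakk>x \<in> carrier G; y \<in> carrier G; g \<in> carrier G\<rbrakk>
    \<Longrightarrow> conjugate (x \<otimes> y) g = conjugate x g \<otimes> conjugate y g"
  by (simp add: conjugate_def m_assoc inv_mult_cancel)

lemma conjugate_inv:
  "\<lbrakk>x \<in> carrier G; g \<in> carrier G\<rbrakk> \<Longrightarrow> conjugate (inv x) g = inv (conjugate x g)"
  by (simp add: conjugate_def m_assoc inv_mult_group)

lemma conjugate_conjugate: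
  "\<lbrakk>x \<in> carrier G; g \<in> carrier G; h \<in> carrier G\<rbrakk>
    \<Longrightarrow> conjugate (conjugate x g) h = conjugate x (g \<otimes> h)"
  by (simp add: conjugate_def m_assoc inv_mult_group)

lemma conjugate_pow:
  "\<lbrakk>x \<in> carrier G; g \<in> carrier G\<rbrakk> \<Longrightarrow> conjugate x g [^] (n::nat) = conjugate (x [^] n) g"
  by (induction n) (simp_all add: conjugate_mult)

lemma mult_conjugate:
  "\<lbrakk>x \<in> carrier G; g \<in> carrier G\<rbrakk> \<Longrightarrow> x \<otimes> g = g \<otimes> conjugate x g"
  by (simp add: conjugate_def m_assoc inv_mult_cancel)

lemma conjugate_eq_self_iff:
  "\<lbrakk>x \<in> carrier G; g \<in> carrier G\<rbrakk> \<Longrightarrow> conjugate x g = x \<longleftrightarrow> x \<otimes> g = g \<otimes> x"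
  using l_cancel[of g "conjugate x g" x] mult_conjugate[of x g] by auto

text \<open>Moving a letter to the front of a word costs only conjugating the letters it passes.\<close>

lemma list_mult_pull_left:
  "\<lbrakk>set xs \<subseteq> carrier G; g \<in> carrier G\<rbrakk>
    \<Longrightarrow> list_mult xs \<otimes> g = g \<otimes> list_mult (map (\<lambda>x. conjugate x g) xs)"
proof (induction xs)
  case (Cons x xs)
  let ?ys = "map (\<lambda>x. conjugate x g) xs"
  have c: "x \<in> carrier G" "list_mult xs \<in> carrier G" "list_mult ?ys \<in> carrier G"
    using Cons.prems by (auto intro!: list_mult_closed conjugate_closed)
  have "list_mult (x # xs) \<otimes> g = x \<otimes> (g \<otimes> list_mult ?ys)"
    using Cons c by (simp add: m_assoc)
  also have "\<dots> = (x \<otimes> g) \<otimes> list_mult ?ys"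
    using Cons c by (simp add: m_assoc)
  also have "\<dots> = g \<otimes> list_mult (map (\<lambda>x. conjugate x g) (x # xs))"
    unfolding mult_conjugate[OF c(1) Cons.prems(2)] using Cons.prems c by (simp add: m_assoc)
  finally show ?case .
qed simp

text \<open>A letter \<open>x\<close> that occurs twice can be moved next to its first occurrence; the two then merge into
  the single letter \<open>x \<otimes> x\<close>.  So a shortest word for a given element has distinct letters.\<close>

lemma dietzmann_distinct_word:
  assumes Y: "Y \<subseteq> carrier G" "\<And>x. x \<in> Y \<Longrightarrow> x \<otimes> x \<in> Y"
      "\<And>x y. \<lbrakk>x \<in> Y; y \<in> Y\<rbrakk> \<Longrightarrow> conjugate x y \<in> Y"
    and "set xs \<subseteq> Y"
  shows "\<exists>ys. set ys \<subseteq> Y \<and> distinct ys \<and> list_mult ys = list_mult xs"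
  using assms(4)
proof (induction xs rule: length_induct)
  case (1 xs)
  show ?case
  proof (cases "distinct xs")
    case False
    then obtain as bs cs x where xs: "xs = as @ [x] @ bs @ [x] @ cs"
      using not_distinct_decomp by blast
    define ys where "ys = as @ (x \<otimes> x) # map (\<lambda>b. conjugate b x) bs @ cs"
    have sub: "set as \<subseteq> Y" "set bs \<subseteq> Y" "set cs \<subseteq> Y" "x \<in> Y" using xs 1 by auto
    then have car: "set as \<subseteq> carrier G" "set bs \<subseteq> carrier G" "set cs \<subseteq> carrier G" "x \<in> carrier G"
      using Y(1) by auto
    have bs': "set (map (\<lambda>b. conjugate b x) bs) \<subseteq> carrier G" using car by auto
    have "list_mult xs = list_mult as \<otimes> (x \<otimes> ((list_mult bs \<otimes> x) \<otimes> list_mult cs))"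
      using car by (simp add: xs list_mult_append list_mult_closed m_assoc)
    also have "\<dots> = list_mult ys"
      unfolding list_mult_pull_left[OF car(2,4)]
      using car bs' by (simp add: ys_def list_mult_append[OF car(1)] list_mult_append[OF bs' car(3)]
          list_mult_closed m_assoc)
    finally have "list_mult ys = list_mult xs" ..
    moreover have "set ys \<subseteq> Y" "length ys < length xs"
      using sub Y by (auto simp: ys_def xs)
    ultimately show ?thesis using 1(1) by metis
  qed (use 1 in auto)
qed

text \<open>Every element of the generated subgroup is a word with distinct letters from \<open>Y\<close>.\<close>

lemma dietzmann:
  assumes Y: "Y \<subseteq> carrier G" "finite Y" "\<one> \<in> Y" "\<And>x. x \<in> Y \<Longrightarrow> inv x \<in> Y"
    "\<And>x. x \<in> Y \<Longrightarrow> x \<otimes> x \<in> Y" "\<And>x y. \<lbrakk>x \<in> Y; y \<in> Y\<rbrakk> \<Longrightarrow> conjugate x y \<in> Y"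
  shows "finite (generate G Y) \<and> card (generate G Y) \<le> card Y ^ card Y"
proof -
  have word: "\<exists>xs. set xs \<subseteq> Y \<and> list_mult xs = z" if "z \<in> generate G Y" for z
    using that
  proof induction
    case one then show ?case by (intro exI[of _ "[]"]) simp
  next
    case (incl h) then show ?case using Y(1) by (intro exI[of _ "[h]"]) auto
  next
    case (inv h) then show ?case using Y(1,4) by (intro exI[of _ "[inv h]"]) auto
  next
    case (eng h1 h2)
    then obtain xs ys where "set xs \<subseteq> Y" "list_mult xs = h1" "set ys \<subseteq> Y" "list_mult ys = h2" by blast
    then show ?case using Y(1) by (intro exI[of _ "xs @ ys"]) (simp add: list_mult_append)
  qed
  let ?L = "{xs. set xs \<subseteq> Y \<and> length xs = card Y}"
  have "generate G Y \<subseteq> list_mult ` ?L"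
  proof
    fix z assume "z \<in> generate G Y"
    then obtain ys where ys: "set ys \<subseteq> Y" "distinct ys" "list_mult ys = z"
      using word dietzmann_distinct_word[OF Y(1,5,6)] by metis
    then have "length ys \<le> card Y" by (metis distinct_card card_mono Y(2))
    \<comment> \<open>Padding with the unit makes all words equally long, so that they are easy to count.\<close>
    moreover have "list_mult (ys @ replicate (card Y - length ys) \<one>) = z"
      using ys Y(1) by (subst list_mult_append) (auto simp: list_mult_replicate_one list_mult_closed)
    ultimately show "z \<in> list_mult ` ?L"
      using ys Y(3) by (intro image_eqI[of _ _ "ys @ replicate (card Y - length ys) \<one>"]) auto
  qed
  moreover have "finite ?L" "card ?L = card Y ^ card Y"
    using Y(2) by (simp_all add: finite_lists_length_eq card_lists_length_eq)
  ultimately show ?thesis using surj_card_le[of ?L "generate G Y" list_mult]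
      finite_surj[of ?L "generate G Y" list_mult] by simp
qed

end

section \<open>Elements of order prime to p\<close>

context group
begin

lemma pow_cong:
  assumes "x \<in> carrier G" "x [^] (n::nat) = \<one>" "[s = t] (mod n)"
  shows "x [^] (s::nat) = x [^] t"
proof -
  obtain k l where "t + k * n = s + l * n" using assms(3) cong_iff_lin_nat by blast
  then have "x [^] (t + k * n) = x [^] (s + l * n)" by simp
  moreover have "x [^] (u + v * n) = x [^] u" for u v :: nat
    using assms by (simp add: nat_pow_mult[symmetric] mult.commute nat_pow_pow[symmetric])
  ultimately show ?thesis by simp
qed

lemma pow_one_mult: "\<lbrakk>x \<in> carrier G; x [^] (a::nat) = \<one>\<rbrakk> \<Longrightarrow> x [^] (a * b) = \<one>"
  by (metis nat_pow_one nat_pow_pow)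

text \<open>The splitting of a torsion element into its \<open>a\<close>-part and its \<open>b\<close>-part, both powers of it.\<close>

lemma coprime_split:
  assumes x: "x \<in> carrier G" "x [^] (a * b) = \<one>" and ab: "coprime a (b::nat)"
  obtains s t :: nat where "x = x [^] s \<otimes> x [^] t" "(x [^] s) [^] a = \<one>" "(x [^] t) [^] b = \<one>"
proof -
  obtain s where s: "[s = 1] (mod a)" "[s = 0] (mod b)"
    using binary_chinese_remainder_nat[OF ab, of 1 0] by blast
  obtain t where t: "[t = 0] (mod a)" "[t = 1] (mod b)"
    using binary_chinese_remainder_nat[OF ab, of 0 1] by blast
  have "[s + t = 1] (mod a)" "[s + t = 1] (mod b)"
    using cong_add[OF s(1) t(1)] cong_add[OF s(2) t(2)] by simp_all
  then have "[s + t = 1] (mod a * b)" using ab by (simp add: coprime_cong_mult_nat)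
  then have "x [^] (s + t) = x" using pow_cong[OF x, of "s + t" 1] x by simp
  then have "x = x [^] s \<otimes> x [^] t" using x by (simp add: nat_pow_mult)
  moreover obtain k where "s = b * k" using s(2) by (metis cong_0_iff dvdE)
  then have "s * a = a * b * k" by simp
  then have "(x [^] s) [^] a = \<one>" using pow_one_mult[OF x, of k] x(1) by (metis nat_pow_pow)
  moreover obtain l where "t = a * l" using t(1) by (metis cong_0_iff dvdE)
  then have "t * b = a * b * l" by simp
  then have "(x [^] t) [^] b = \<one>" using pow_one_mult[OF x, of l] x(1) by (metis nat_pow_pow)
  ultimately show thesis using that by blast
qed

lemma pow_coprime_generates:
  assumes x: "x \<in> carrier G" "x [^] (a::nat) = \<one>" and "coprime a (m::nat)"
  obtains k :: nat where "(x [^] m) [^] k = x"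
proof -
  obtain k where "[m * k = 1] (mod a)"
    using assms(3) cong_solve_coprime_nat[of m a] by (auto simp: coprime_commute)
  then have "x [^] (m * k) = x [^] (1::nat)" using pow_cong x by blast
  then show thesis using that x by (simp add: nat_pow_pow)
qed

lemma subgroup_pow_closed: "\<lbrakk>subgroup H G; x \<in> H\<rbrakk> \<Longrightarrow> x [^] (n::nat) \<in> H"
  by (induction n) (auto simp: subgroup.one_closed subgroup.m_closed)

text \<open>The definitions ask for an exponent rather than for the exact order, because an exponent is
  inherited by powers, conjugates and homomorphic images.\<close>

definition coprime_order :: "nat \<Rightarrow> 'a set" where
  "coprime_order p = {x \<in> carrier G. \<exists>m. coprime m p \<and> x [^] m = \<one>}"

definition prime_power_order :: "nat \<Rightarrow> 'a set" where
  "prime_power_order p = {x \<in> carrier G. \<exists>k. x [^] (p ^ k) = \<one>}"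

lemma coprime_order_conj:
  "\<lbrakk>x \<in> coprime_order p; g \<in> carrier G\<rbrakk> \<Longrightarrow> conjugate x g \<in> coprime_order p"
  by (auto simp: coprime_order_def conjugate_pow)

lemma coprime_order_pow: "x \<in> coprime_order p \<Longrightarrow> x [^] (n::nat) \<in> coprime_order p"
  by (auto simp: coprime_order_def nat_pow_pow) (metis mult.commute pow_one_mult)

lemma coprime_order_inv: "x \<in> coprime_order p \<Longrightarrow> inv x \<in> coprime_order p"
  by (auto simp: coprime_order_def nat_pow_inv)

lemma one_coprime_order: "\<one> \<in> coprime_order p"
  by (auto simp: coprime_order_def intro: exI[of _ 1])

lemma prime_power_order_conj:
  "\<lbrakk>x \<in> prime_power_order p; g \<in> carrier G\<rbrakk> \<Longrightarrow> conjugate x g \<in> prime_power_order p"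
  by (auto simp: prime_power_order_def conjugate_pow) (metis conjugate_one_left)

lemma prime_power_order_pow: "x \<in> prime_power_order p \<Longrightarrow> x [^] (n::nat) \<in> prime_power_order p"
  by (auto simp: prime_power_order_def nat_pow_pow) (metis mult.commute pow_one_mult)

lemma prime_power_order_inv: "x \<in> prime_power_order p \<Longrightarrow> inv x \<in> prime_power_order p"
  by (auto simp: prime_power_order_def nat_pow_inv)

end

section \<open>Subgroups containing all elements of order prime to p\<close>

context group
begin

lemma rcoset_eq_iff:
  assumes H: "subgroup H G" and x: "x \<in> carrier G" "y \<in> carrier G"
  shows "H #> x = H #> y \<longleftrightarrow> x \<otimes> inv y \<in> H"
proof -
  have "H #> x = H #> y \<longleftrightarrow> x \<in> H #> y"
    using repr_independence[OF _ x(2) H] rcos_self[OF x(1) H] by auto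
  then show ?thesis using subgroup.rcos_module[OF H is_group x(2,1)] by simp
qed

text \<open>A prime \<open>q\<close> other than \<open>p\<close> cannot divide the index: a Sylow argument gives a \<open>q\<close>-subgroup of
  order larger than the \<open>q\<close>-part of \<open>|D|\<close>, yet its elements have order prime to \<open>p\<close> and so lie in \<open>D\<close>.\<close>

lemma prime_dvd_index:
  assumes fin: "finite (carrier G)" and p: "Factorial_Ring.prime (p::nat)" and D: "subgroup D G"
    and sub: "coprime_order p \<subseteq> D" and proper: "D \<noteq> carrier G"
  shows "p dvd card (rcosets D)"
proof (rule ccontr)
  assume np: "\<not> p dvd card (rcosets D)"
  interpret D: subgroup D G by fact
  have finD: "finite D" using fin D.subset finite_subset by blast
  have lag: "card (rcosets D) * card D = order G" using lagrange[OF D] by simp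
  have "card (rcosets D) \<noteq> 1"
    using lag proper card_subset_eq[OF fin D.subset] by (auto simp: order_def)
  then obtain q where q: "Factorial_Ring.prime q" "q dvd card (rcosets D)" using prime_factor_nat by blast
  then obtain r where r: "card (rcosets D) = q * r" by blast
  have "card D > 0" using finD D.one_closed card_gt_0_iff[of D] by blast
  then obtain b c where bc: "\<not> q dvd c" "card D = c * q ^ b"
    using prime_power_canonical[OF q(1)] by blast
  have "order G = q ^ Suc b * (r * c)" using lag r bc by (simp add: algebra_simps)
  then obtain H where H: "subgroup H G" "card H = q ^ Suc b"
    using sylow_thm[OF q(1) is_group _ fin] by blast
  interpret H: subgroup H G by fact
  have "H \<subseteq> D"
  proof
    fix h assume h: "h \<in> H"
    have "h [^] card H = \<one>"
      using group.pow_order_eq_1[OF H.subgroup_is_group[OF is_group], of h] h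
      by (simp add: order_def flip: nat_pow_consistent)
    moreover have "coprime (q ^ Suc b) p"
      using q np p primes_coprime[OF q(1) p] by (metis coprime_power_left_iff)
    ultimately have "h \<in> coprime_order p"
      unfolding coprime_order_def using H(2) H.mem_carrier[OF h]
      by (auto intro: exI[of _ "q ^ Suc b"])
    then show "h \<in> D" using sub by blast
  qed
  then have "subgroup H (G\<lparr>carrier := D\<rparr>)" using subgroup_incl[OF H(1) D] by simp
  then have "card (rcosets\<^bsub>G\<lparr>carrier := D\<rparr>\<^esub> H) * card H = card D"
    using group.lagrange[OF D.subgroup_is_group[OF is_group], of H] by (simp add: order_def)
  then have "card H dvd card D" by (metis dvd_triv_right)
  then have "q dvd c" using H(2) bc q(1) by (simp add: prime_gt_0_nat)
  with bc show False by simp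
qed

text \<open>This is the growth of normalizers in the \<open>p\<close>-group that arises by dividing out the elements of
  order prime to \<open>p\<close>.  \<open>M\<close> acts on its right cosets by multiplication.  The number of
  cosets is divisible by \<open>p\<close>, and so is the length of every orbit of more than one coset, by
  \<open>prime_dvd_index\<close> for the stabilizer in \<open>M\<close>.  So \<open>p\<close> divides the number of fixed cosets.  The coset
  \<open>M\<close> is fixed, hence another coset \<open>M x\<close> is fixed too, and then \<open>x\<close> normalizes \<open>M\<close>.\<close>

lemma normalizer_grows:
  assumes fin: "finite (carrier G)" and p: "Factorial_Ring.prime (p::nat)" and M: "subgroup M G"
    and sub: "coprime_order p \<subseteq> M" and proper: "M \<noteq> carrier G"
  obtains x where "x \<in> carrier G" "x \<notin> M" "\<And>m. m \<in> M \<Longrightarrow> conjugate m x \<in> M"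
proof -
  interpret M: subgroup M G by fact
  have finR: "finite (rcosets M)" using fin by (simp add: RCOSETS_def)
  have cos_sub: "C \<subseteq> carrier G" if "C \<in> rcosets M" for C
    using that r_coset_subset_G[OF M.subset] by (auto simp: RCOSETS_def)
  have cos_assoc: "C #> m #> m' = C #> (m \<otimes> m')"
    if "C \<in> rcosets M" "m \<in> M" "m' \<in> M" for C m m'
    using that cos_sub[OF that(1)] M.mem_carrier by (auto simp: coset_mult_assoc)
  have cos_one: "C #> \<one> = C" if "C \<in> rcosets M" for C
    using cos_sub[OF that] by (auto simp: coset_mult_one)
  have cos_closed: "C #> m \<in> rcosets M" if "C \<in> rcosets M" "m \<in> M" for C m
    using that M.subset M.mem_carrier by (auto simp: RCOSETS_def coset_mult_assoc)
  define Fix where "Fix = {C \<in> rcosets M. \<forall>m\<in>M. C #> m = C}"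
  define orb where "orb C = (\<lambda>m. C #> m) ` M" for C
  have orb_self: "C \<in> orb C" if "C \<in> rcosets M" for C
    using cos_one[OF that] M.one_closed unfolding orb_def by (metis image_eqI)
  have orb_shift: "orb (C #> m) = orb C" if C: "C \<in> rcosets M" "m \<in> M" for C m
  proof -
    have 1: "C #> m' = C #> m #> (inv m \<otimes> m')" if "m' \<in> M" for m'
      using C that M.mem_carrier by (simp add: cos_assoc inv_mult_cancel)
    have 2: "C #> m #> m' = C #> (m \<otimes> m')" if "m' \<in> M" for m'
      using C that by (rule cos_assoc)
    show ?thesis unfolding orb_def
    proof (intro equalityI image_subsetI)
      fix m' assume "m' \<in> M"
      then show "C #> m #> m' \<in> (\<lambda>m. C #> m) ` M"
        using C(2) by (intro image_eqI[where x = "m \<otimes> m'"]) (simp_all add: 2)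
    next
      fix m' assume "m' \<in> M"
      then show "C #> m' \<in> (\<lambda>m'. C #> m #> m') ` M"
        using C(2) 1[OF \<open>m' \<in> M\<close>] M.m_inv_closed M.m_closed by blast
    qed
  qed
  have union: "\<Union> (orb ` (rcosets M - Fix)) = rcosets M - Fix"
  proof
    show "rcosets M - Fix \<subseteq> \<Union> (orb ` (rcosets M - Fix))" using orb_self by blast
    have "C #> m \<in> rcosets M - Fix" if C: "C \<in> rcosets M - Fix" "m \<in> M" for C m
    proof
      show "C #> m \<in> rcosets M" using C cos_closed by blast
      show "C #> m \<notin> Fix"
      proof
        assume f: "C #> m \<in> Fix"
        have "C = C #> m #> inv m" using C M.mem_carrier by (simp add: cos_assoc cos_one)
        also have "\<dots> = C #> m" using f C by (simp add: Fix_def)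
        finally show False using f C by auto
      qed
    qed
    then show "\<Union> (orb ` (rcosets M - Fix)) \<subseteq> rcosets M - Fix" by (auto simp: orb_def)
  qed
  have "p dvd card (\<Union> (orb ` (rcosets M - Fix)))"
  proof (rule dvd_partition)
    show "finite (\<Union> (orb ` (rcosets M - Fix)))" using union finR by simp
    show "\<forall>O1\<in>orb ` (rcosets M - Fix). \<forall>O2\<in>orb ` (rcosets M - Fix). O1 \<noteq> O2 \<longrightarrow> O1 \<inter> O2 = {}"
    proof (intro ballI impI, rule ccontr)
      fix O1 O2 assume "O1 \<in> orb ` (rcosets M - Fix)" "O2 \<in> orb ` (rcosets M - Fix)"
        and ne: "O1 \<noteq> O2" "O1 \<inter> O2 \<noteq> {}"
      then obtain C1 C2 where C: "O1 = orb C1" "O2 = orb C2" "C1 \<in> rcosets M" "C2 \<in> rcosets M" by blast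
      from ne C obtain m1 m2 where m: "m1 \<in> M" "m2 \<in> M" "C1 #> m1 = C2 #> m2"
        by (auto simp: orb_def)
      have "O1 = O2" using orb_shift[OF C(3) m(1)] orb_shift[OF C(4) m(2)] C m by simp
      with ne show False by simp
    qed
    show "\<forall>O1\<in>orb ` (rcosets M - Fix). p dvd card O1"
    proof
      fix O1 assume "O1 \<in> orb ` (rcosets M - Fix)"
      then obtain C where C: "C \<in> rcosets M" "C \<notin> Fix" "O1 = orb C" by blast
      then obtain x where x: "x \<in> carrier G" "C = M #> x" by (auto simp: RCOSETS_def)
      let ?GM = "G\<lparr>carrier := M\<rparr>"
      interpret GM: group ?GM using M.subgroup_is_group[OF is_group] .
      \<comment> \<open>The stabilizer of the coset \<open>M #> x\<close> in \<open>M\<close>.\<close>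
      define D where "D = {m \<in> M. conjugate m (inv x) \<in> M}"
      have D: "subgroup D G"
        by (rule subgroupI) (use x M.mem_carrier in
            \<open>auto simp: D_def conjugate_inv conjugate_mult intro: exI[of _ \<one>]\<close>)
      have DM: "subgroup D ?GM"
        using subgroup_incl[OF D M] by (auto simp: D_def)
      have fibre: "C #> m = C #> m' \<longleftrightarrow> D #> m = D #> m'" if m: "m \<in> M" "m' \<in> M" for m m'
      proof -
        note mc = m[THEN M.mem_carrier]
        have "C #> m = C #> m' \<longleftrightarrow> (x \<otimes> m) \<otimes> inv (x \<otimes> m') \<in> M"
          using x mc M.subset
          by (simp add: coset_mult_assoc rcoset_eq_iff[OF M])
        also have "(x \<otimes> m) \<otimes> inv (x \<otimes> m') = conjugate (m \<otimes> inv m') (inv x)"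
          using x mc by (simp add: conjugate_def m_assoc inv_mult_group)
        also have "conjugate (m \<otimes> inv m') (inv x) \<in> M \<longleftrightarrow> m \<otimes> inv m' \<in> D"
          using m by (simp add: D_def)
        also have "\<dots> \<longleftrightarrow> D #> m = D #> m'"
          using mc by (simp add: rcoset_eq_iff[OF D])
        finally show ?thesis .
      qed
      have "card (orb C) = card ((\<lambda>m. D #> m) ` M)"
        unfolding orb_def
        by (rule antisym; rule card_image_le_by_fibres[THEN conjunct2])
          (use fibre fin M.subset finite_subset in blast)+
      moreover have "(\<lambda>m. D #> m) ` M = rcosets\<^bsub>?GM\<^esub> D"
        by (auto simp: RCOSETS_def r_coset_def)
      moreover have "p dvd card (rcosets\<^bsub>?GM\<^esub> D)"
      proof (rule GM.prime_dvd_index[OF _ p DM])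
        show "finite (carrier ?GM)" using fin M.subset finite_subset by auto
        have "D \<noteq> M"
        proof
          assume "D = M"
          have "C #> m = C" if m: "m \<in> M" for m
          proof -
            have "D #> m = D #> \<one>"
              using m M M.mem_carrier \<open>D = M\<close> by (simp add: rcoset_eq_iff)
            then have "C #> m = C #> \<one>" using fibre[OF m M.one_closed] by (rule iffD2[rotated])
            then show ?thesis using cos_one C(1) by simp
          qed
          with C show False by (simp add: Fix_def)
        qed
        then show "D \<noteq> carrier ?GM" by simp
        show "GM.coprime_order p \<subseteq> D"
        proof
          fix m assume "m \<in> GM.coprime_order p"
          then have "m \<in> M" "m \<in> coprime_order p"
            by (auto simp: GM.coprime_order_def coprime_order_def M.mem_carrier simp flip: nat_pow_consistent)
          then show "m \<in> D" using sub x coprime_order_conj[of m p "inv x"] by (auto simp: D_def)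
        qed
      qed
      ultimately show "p dvd card O1" using C by simp
    qed
  qed
  then have "p dvd card (rcosets M - Fix)" using union by simp
  moreover have "p dvd card (rcosets M)" by (rule prime_dvd_index[OF fin p M sub proper])
  moreover have "card (rcosets M) = card (rcosets M - Fix) + card Fix"
    using finR by (subst card_Un_disjoint[symmetric]) (auto simp: Fix_def intro!: arg_cong[of _ _ card])
  ultimately have "p dvd card Fix" by (simp add: dvd_add_right_iff)
  have "M \<in> Fix"
    using M M.subgroup_in_rcosets[OF is_group] M.mem_carrier by (auto simp: Fix_def coset_join2)
  moreover have "finite Fix" using finR by (simp add: Fix_def)
  ultimately have "card Fix > 1"
    using dvd_imp_le[OF \<open>p dvd card Fix\<close>] prime_gt_1_nat[OF p] card_gt_0_iff[of Fix] by fastforce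
  then obtain C where C: "C \<in> Fix" "C \<noteq> M"
    using card_mono[of "{M}" Fix] by fastforce
  then obtain x where x: "x \<in> carrier G" "C = M #> x" by (auto simp: Fix_def RCOSETS_def)
  have conj: "conjugate m (inv x) \<in> M" if m: "m \<in> M" for m
  proof -
    have "x \<otimes> m \<in> C #> m"
      using x rcos_self[OF _ M] m by (auto simp: r_coset_def)
    then have "x \<otimes> m \<in> M #> x" using C m x by (simp add: Fix_def)
    then obtain m' where "m' \<in> M" "x \<otimes> m = m' \<otimes> x" by (auto simp: r_coset_def)
    then have "x \<otimes> m \<otimes> inv x = m'" using x m M.mem_carrier by (simp add: m_assoc)
    then show ?thesis using \<open>m' \<in> M\<close> x by (simp add: conjugate_def)
  qed
  show thesis
  proof (rule that)
    show "inv x \<in> carrier G" using x by simp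
    show "inv x \<notin> M"
    proof
      assume "inv x \<in> M"
      then have "x \<in> M" using M.m_inv_closed x by fastforce
      then show False using C x M M.mem_carrier by (simp add: coset_join2)
    qed
  qed (rule conj)
qed

text \<open>A maximal element among the proper subgroups that contain the elements of order prime to \<open>p\<close> is
  normal, because its normalizer is larger than it.\<close>

lemma normal_proper_supergroup:
  assumes fin: "finite (carrier G)" and p: "Factorial_Ring.prime (p::nat)" and M: "subgroup M G"
    and sub: "coprime_order p \<subseteq> M" and proper: "M \<noteq> carrier G"
  obtains N where "N \<lhd> G" "M \<subseteq> N" "N \<noteq> carrier G"
proof -
  let ?S = "{N. subgroup N G \<and> coprime_order p \<subseteq> N \<and> N \<noteq> carrier G}"
  have "finite ?S"
    by (rule finite_subset[of _ "Pow (carrier G)"]) (use fin subgroup.subset in auto)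
  moreover have "M \<in> ?S" using M sub proper by simp
  ultimately obtain N where N: "N \<in> ?S" "M \<subseteq> N" and max: "\<forall>K\<in>?S. N \<subseteq> K \<longrightarrow> N = K"
    by (elim finite_has_maximal2[THEN bexE]) blast+
  interpret N: subgroup N G using N by blast
  have finN: "finite N" using fin N.subset finite_subset by blast
  obtain x where x: "x \<in> carrier G" "x \<notin> N" "\<And>m. m \<in> N \<Longrightarrow> conjugate m x \<in> N"
    using normalizer_grows[OF fin p] N by blast
  define K where "K = {g \<in> carrier G. (\<lambda>m. conjugate m g) ` N = N}"
  have inj: "inj_on (\<lambda>m. conjugate m g) N" if "g \<in> carrier G" for g
    using that N.mem_carrier by (intro inj_onI) (simp add: conjugate_def)
  have K: "subgroup K G"
  proof (rule subgroupI)
    fix g assume g: "g \<in> K"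
    then have "(\<lambda>m. conjugate m (inv g)) ` (\<lambda>m. conjugate m g) ` N = (\<lambda>m. m) ` N"
      unfolding image_image
      by (intro image_cong) (auto simp: K_def conjugate_conjugate N.mem_carrier)
    then show "inv g \<in> K" using g by (simp add: K_def)
  next
    fix g h assume gh: "g \<in> K" "h \<in> K"
    have "(\<lambda>m. conjugate m (g \<otimes> h)) ` N = (\<lambda>m. conjugate m h) ` (\<lambda>m. conjugate m g) ` N"
      unfolding image_image using gh
      by (intro image_cong) (auto simp: K_def conjugate_conjugate N.mem_carrier)
    then show "g \<otimes> h \<in> K" using gh by (simp add: K_def)
  qed (use N.mem_carrier in \<open>auto simp: K_def intro!: exI[of _ \<one>]\<close>)
  have mem_K: "g \<in> K" if "g \<in> carrier G" "\<And>m. m \<in> N \<Longrightarrow> conjugate m g \<in> N" for g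
    using endo_inj_surj[OF finN _ inj] that by (auto simp: K_def)
  have "N \<subseteq> K"
  proof
    fix g assume "g \<in> N"
    then show "g \<in> K" by (intro mem_K) (simp_all add: conjugate_def)
  qed
  have "K = carrier G"
  proof (rule ccontr)
    assume "K \<noteq> carrier G"
    then have "K \<in> ?S" using K N \<open>N \<subseteq> K\<close> by auto
    then have "N = K" using max \<open>N \<subseteq> K\<close> by simp
    moreover have "x \<in> K" using x(1,3) by (rule mem_K)
    ultimately show False using x(2) by simp
  qed
  then have "N \<lhd> G"
  proof (intro normal_invI)
    fix g m assume "K = carrier G" "g \<in> carrier G" "m \<in> N"
    then have "conjugate m (inv g) \<in> N" by (auto simp: K_def)
    then show "g \<otimes> m \<otimes> inv g \<in> N" using \<open>g \<in> carrier G\<close> by (simp add: conjugate_def)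
  qed (use N in blast)
  then show thesis using that N by blast
qed

end

section \<open>A bound on groups normally generated by a subgroup\<close>

context group
begin

lemma generated_by_prime_power_orders:
  assumes A: "subgroup A G"
  shows "\<lbrakk>x \<in> A; x [^] (m::nat) = \<one>; m > 0\<rbrakk>
    \<Longrightarrow> x \<in> generate G {h \<in> A. \<exists>p. Factorial_Ring.prime p \<and> h \<in> prime_power_order p}"
    (is "_ \<Longrightarrow> _ \<Longrightarrow> _ \<Longrightarrow> _ \<in> generate G ?Y")
proof (induction m arbitrary: x rule: less_induct)
  case (less m)
  interpret A: subgroup A G by fact
  have x: "x \<in> carrier G" using less.prems A.mem_carrier by blast
  show ?case
  proof (cases "m = 1")
    case True
    then show ?thesis using less.prems x generate.one[of G ?Y] by simp
  next
    case False
    then obtain p where p: "Factorial_Ring.prime p" "p dvd m" using prime_factor_nat by blast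
    obtain c b where bc: "\<not> p dvd c" "m = c * p ^ b"
      using prime_power_canonical[OF p(1) less.prems(3)] by blast
    have "b \<noteq> 0" using bc p by (auto intro: ccontr)
    then have "p ^ b > 1" using prime_gt_1_nat[OF p(1)] by (intro one_less_power) auto
    moreover have "c > 0" using bc less.prems by (auto intro: ccontr)
    ultimately have "c < m" using bc by simp
    have "coprime (p ^ b) c" using p bc by (simp add: prime_imp_coprime)
    then obtain s t :: nat where st: "x = x [^] s \<otimes> x [^] t" "(x [^] s) [^] (p ^ b) = \<one>" "(x [^] t) [^] c = \<one>"
      using coprime_split[OF x, of "p ^ b" c] less.prems bc by (metis mult.commute)
    have "x [^] s \<in> ?Y"
      using st(2) p(1) x subgroup_pow_closed[OF A less.prems(1)] by (auto simp: prime_power_order_def)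
    then have "x [^] s \<in> generate G ?Y" by (rule generate.incl)
    moreover have "x [^] t \<in> generate G ?Y"
      using less.IH[OF \<open>c < m\<close> _ st(3) \<open>c > 0\<close>] subgroup_pow_closed[OF A less.prems(1)] by blast
    ultimately show ?thesis by (subst st(1)) (rule generate.eng)
  qed
qed

end

text \<open>The extension \<open>G\<close> of a subgroup of \<open>Q\<close> is to be bounded independently of the kernel of \<open>\<kappa>\<close>.  The
  condition \<open>kernel_commutes\<close> holds when \<open>\<kappa>\<close> is a composite of homomorphisms with central kernels, and
  it passes to subgroups at once.\<close>

locale normally_generated_extension = group G for G (structure) +
  fixes Q :: "'q monoid" and \<kappa> and A
  assumes finite_carrier: "finite (carrier G)"
    and Q: "group Q" "finite (carrier Q)"
    and kappa: "\<kappa> \<in> hom G Q"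
    and kernel_commutes: "\<lbrakk>x \<in> carrier G; \<kappa> x = \<one>\<^bsub>Q\<^esub>; y \<in> carrier G; coprime a b;
      x [^] (a::nat) = \<one>; y [^] (b::nat) = \<one>\<rbrakk> \<Longrightarrow> x \<otimes> y = y \<otimes> x"
    and A: "subgroup A G"
    and normal_closure_A: "\<lbrakk>N \<lhd> G; A \<subseteq> N\<rbrakk> \<Longrightarrow> N = carrier G"
begin

lemma kappa_group_hom: "group_hom G Q \<kappa>"
  using Q kappa by (simp add: group_hom_def group_hom_axioms_def is_group)

text \<open>The part of the kernel that does not contribute to the number of conjugates of an element of
  \<open>p\<close>-power order.  It contains all elements of the kernel of order prime to \<open>p\<close>, and unlike the set
  of those it is visibly a normal subgroup.\<close>

definition kernel_centralizer :: "nat \<Rightarrow> 'a set" where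
  "kernel_centralizer p =
    {x \<in> carrier G. \<kappa> x = \<one>\<^bsub>Q\<^esub> \<and> (\<forall>y\<in>prime_power_order p. conjugate y x = y)}"

lemma prime_power_carrier: "y \<in> prime_power_order p \<Longrightarrow> y \<in> carrier G"
  by (simp add: prime_power_order_def)

lemma kernel_centralizer_normal: "kernel_centralizer p \<lhd> G"
proof (rule normal_invI)
  interpret \<kappa>: group_hom G Q \<kappa> by (rule kappa_group_hom)
  show "subgroup (kernel_centralizer p) G"
  proof (rule subgroupI)
    fix x assume x: "x \<in> kernel_centralizer p"
    have "conjugate y (inv x) = y" if "y \<in> prime_power_order p" for y
    proof -
      have "conjugate (conjugate y x) (inv x) = y"
        using x that prime_power_carrier by (subst conjugate_conjugate) (auto simp: kernel_centralizer_def)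
      then show ?thesis using x that by (simp add: kernel_centralizer_def)
    qed
    then show "inv x \<in> kernel_centralizer p" using x by (auto simp: kernel_centralizer_def)
  next
    fix x y assume "x \<in> kernel_centralizer p" "y \<in> kernel_centralizer p"
    then show "x \<otimes> y \<in> kernel_centralizer p"
      by (auto simp: kernel_centralizer_def prime_power_carrier simp flip: conjugate_conjugate)
  qed (auto simp: kernel_centralizer_def prime_power_carrier intro: exI[of _ \<one>])
  fix g x assume g: "g \<in> carrier G" and x: "x \<in> kernel_centralizer p"
  have xc: "x \<in> carrier G" "\<kappa> x = \<one>\<^bsub>Q\<^esub>" using x by (auto simp: kernel_centralizer_def)
  have "conjugate y (g \<otimes> x \<otimes> inv g) = y" if y: "y \<in> prime_power_order p" for y
  proof -
    have yc: "y \<in> carrier G" using y by (rule prime_power_carrier)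
    have "conjugate y (g \<otimes> x \<otimes> inv g) = conjugate (conjugate (conjugate y g) x) (inv g)"
      using g xc yc by (simp add: conjugate_conjugate m_assoc)
    also have "conjugate (conjugate y g) x = conjugate y g"
      using x y g prime_power_order_conj by (simp add: kernel_centralizer_def)
    also have "conjugate (conjugate y g) (inv g) = y"
      using g yc by (simp add: conjugate_conjugate)
    finally show ?thesis .
  qed
  then show "g \<otimes> x \<otimes> inv g \<in> kernel_centralizer p"
    using g xc by (simp add: kernel_centralizer_def)
qed

text \<open>Two elements of order prime to \<open>p\<close> with the same image differ by an element \<open>k\<close> of the kernel.  Split
  \<open>k\<close> into a part of order prime to \<open>p\<close>, which lies in the centralizer by \<open>kernel_commutes\<close>, and a part of
  \<open>p\<close>-power order, which commutes with both elements and must therefore vanish modulo the centralizer.\<close>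

lemma coprime_order_determined_by_image:
  assumes p: "Factorial_Ring.prime p"
    and y: "y \<in> coprime_order p" "y' \<in> coprime_order p" "\<kappa> y = \<kappa> y'"
  shows "kernel_centralizer p #> y = kernel_centralizer p #> y'"
proof -
  interpret \<kappa>: group_hom G Q \<kappa> by (rule kappa_group_hom)
  let ?D = "kernel_centralizer p"
  interpret D: normal ?D G by (rule kernel_centralizer_normal)
  interpret L: group "G Mod ?D" by (rule D.factorgroup_is_group)
  interpret \<pi>: group_hom G "G Mod ?D" "\<lambda>x. ?D #> x"
    using D.r_coset_hom_Mod by (simp add: group_hom_def group_hom_axioms_def is_group L.is_group)
  obtain m m' where m: "coprime m p" "y [^] m = \<one>" "coprime m' p" "y' [^] m' = \<one>"
    using y by (auto simp: coprime_order_def)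
  have yc: "y \<in> carrier G" "y' \<in> carrier G" using y by (auto simp: coprime_order_def)
  define k where "k = y \<otimes> inv y'"
  have k: "k \<in> carrier G" "\<kappa> k = \<one>\<^bsub>Q\<^esub>" "y = k \<otimes> y'"
    using yc y(3) by (simp_all add: k_def m_assoc \<kappa>.hom_inv)
  have "order G > 0" using finite_carrier order_gt_0_iff_finite by blast
  then obtain c b where bc: "\<not> p dvd c" "order G = c * p ^ b"
    using prime_power_canonical[OF p] by blast
  have cop: "coprime (p ^ e) c" for e using p bc by (simp add: prime_imp_coprime)
  have "k [^] (p ^ b * c) = \<one>" using pow_order_eq_1[OF k(1)] bc by (simp add: mult.commute)
  then obtain s t :: nat where st: "k = k [^] s \<otimes> k [^] t" "(k [^] s) [^] (p ^ b) = \<one>" "(k [^] t) [^] c = \<one>"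
    using coprime_split[OF k(1) _ cop] by metis
  define u v where "u = k [^] s" "v = k [^] t"
  have uv: "u \<in> carrier G" "v \<in> carrier G" "\<kappa> u = \<one>\<^bsub>Q\<^esub>" "\<kappa> v = \<one>\<^bsub>Q\<^esub>" "k = v \<otimes> u"
    using k st(1) by (simp_all add: u_v_def \<kappa>.hom_nat_pow nat_pow_comm)
  \<comment> \<open>The part \<open>v\<close> of order prime to \<open>p\<close> commutes with the elements of \<open>p\<close>-power order.\<close>
  have "v \<in> ?D"
  proof -
    have "conjugate z v = z" if z: "z \<in> prime_power_order p" for z
    proof -
      obtain e where e: "z [^] (p ^ e) = \<one>" using z by (auto simp: prime_power_order_def)
      have "v \<otimes> z = z \<otimes> v"
        using kernel_commutes[OF uv(2,4) prime_power_carrier[OF z] _ _ e, of c] st(3) cop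
        by (simp add: u_v_def coprime_commute)
      then show ?thesis using conjugate_eq_self_iff[OF prime_power_carrier[OF z] uv(2)] by metis
    qed
    then show ?thesis using uv(2,4) unfolding kernel_centralizer_def by blast
  qed
  \<comment> \<open>The part \<open>u\<close> of \<open>p\<close>-power order commutes with \<open>y'\<close>, so that modulo \<open>v\<close> it is the
    \<open>p\<close>-part of \<open>y = v u y'\<close>; but \<open>y\<close> has order prime to \<open>p\<close>.\<close>
  have "u \<otimes> y' = y' \<otimes> u"
    using kernel_commutes[OF uv(1,3) yc(2), of "p ^ b" m'] st(2) m by (simp add: u_v_def coprime_commute)
  then have pow: "(u \<otimes> y') [^] (m * m') = u [^] (m * m')"
    using uv yc pow_one_mult[OF yc(2) m(4), of m] by (simp add: pow_mult_distrib mult.commute)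
  have Dv: "?D #> v = \<one>\<^bsub>G Mod ?D\<^esub>"
    using \<open>v \<in> ?D\<close> uv D.subgroup_axioms by (simp add: FactGroup_def coset_join2)
  have "?D #> y = ?D #> (u \<otimes> y')"
  proof -
    have "?D #> y = (?D #> v) \<otimes>\<^bsub>G Mod ?D\<^esub> (?D #> (u \<otimes> y'))"
      using \<pi>.hom_mult[of v "u \<otimes> y'"] uv yc k(3) by (simp add: m_assoc)
    also have "\<dots> = ?D #> (u \<otimes> y')" unfolding Dv using uv yc by (intro L.l_one \<pi>.hom_closed) auto
    finally show ?thesis .
  qed
  then have eq: "(?D #> y) [^]\<^bsub>G Mod ?D\<^esub> (m * m') = ?D #> (u [^] (m * m'))"
    unfolding pow[symmetric] using \<pi>.hom_nat_pow[of "u \<otimes> y'" "m * m'"] uv(1) yc(2)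
    by (metis m_closed)
  have "(?D #> y) [^]\<^bsub>G Mod ?D\<^esub> (m * m') = \<one>\<^bsub>G Mod ?D\<^esub>"
    using \<pi>.hom_nat_pow[OF yc(1), of "m * m'"] pow_one_mult[OF yc(1) m(2), of m'] \<pi>.hom_one
    by metis
  then have "?D #> (u [^] (m * m')) = ?D" using eq by (simp add: FactGroup_def)
  then have "u [^] (m * m') \<in> ?D"
    using rcos_self[OF _ D.subgroup_axioms, of "u [^] (m * m')"] uv by simp
  moreover have "coprime (p ^ b) (m * m')" using m by (simp add: coprime_commute)
  then obtain l :: nat where "(u [^] (m * m')) [^] l = u"
    using pow_coprime_generates[OF uv(1)] st(2) by (metis u_v_def(1))
  ultimately have "u \<in> ?D" using subgroup_pow_closed[OF D.subgroup_axioms] by metis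
  then have "k \<in> ?D" using \<open>v \<in> ?D\<close> uv(5) by simp
  then show ?thesis
    using yc by (simp add: rcoset_eq_iff[OF D.subgroup_axioms] k_def)
qed

text \<open>Otherwise the product would lie in a proper normal subgroup, and that subgroup contains \<open>A\<close>.\<close>

lemma carrier_eq_coprime_order_times_A:
  assumes p: "Factorial_Ring.prime p"
  shows "carrier G = generate G (coprime_order p) <#> A"
proof (rule ccontr)
  let ?R = "generate G (coprime_order p)"
  assume ne: "carrier G \<noteq> ?R <#> A"
  have sub: "coprime_order p \<subseteq> carrier G" by (auto simp: coprime_order_def)
  have R: "?R \<lhd> G"
  proof (rule normal_generateI[OF sub])
    fix h g assume "h \<in> coprime_order p" "g \<in> carrier G"
    then show "g \<otimes> h \<otimes> inv g \<in> coprime_order p"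
      using coprime_order_conj[of h p "inv g"] by (simp add: conjugate_def)
  qed
  interpret A: subgroup A G by (rule A)
  interpret R: normal ?R G by (rule R)
  have RA: "subgroup (?R <#> A) G" using mult_norm_subgroup R A by blast
  have "coprime_order p \<subseteq> ?R <#> A"
  proof
    fix x assume "x \<in> coprime_order p"
    then have "x \<in> ?R" "x = x \<otimes> \<one>" using sub generate.incl[of x "coprime_order p" G] by auto
    then show "x \<in> ?R <#> A" using A.one_closed unfolding set_mult_def by blast
  qed
  then obtain N where N: "N \<lhd> G" "?R <#> A \<subseteq> N" "N \<noteq> carrier G"
    using normal_proper_supergroup[OF finite_carrier p RA] ne by metis
  have "A \<subseteq> ?R <#> A"
  proof
    fix x assume "x \<in> A"
    then have "x = \<one> \<otimes> x" by simp
    then show "x \<in> ?R <#> A" using \<open>x \<in> A\<close> R.one_closed unfolding set_mult_def by blast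
  qed
  then show False using normal_closure_A N by blast
qed

text \<open>In the quotient by the centralizer the elements of order prime to \<open>p\<close> have at most \<open>order Q\<close>
  images, so Dietzmann's lemma applies there; the factor \<open>card A\<close> comes from
  \<open>carrier_eq_coprime_order_times_A\<close>.\<close>

lemma index_kernel_centralizer:
  assumes p: "Factorial_Ring.prime p"
  shows "card ((\<lambda>x. kernel_centralizer p #> x) ` carrier G) \<le> order Q ^ order Q * card A"
proof -
  let ?D = "kernel_centralizer p"
  let ?R = "generate G (coprime_order p)"
  interpret A: subgroup A G by (rule A)
  interpret D: normal ?D G by (rule kernel_centralizer_normal)
  interpret L: group "G Mod ?D" by (rule D.factorgroup_is_group)
  interpret \<pi>: group_hom G "G Mod ?D" "\<lambda>x. ?D #> x"
    using D.r_coset_hom_Mod by (simp add: group_hom_def group_hom_axioms_def is_group L.is_group)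
  define \<pi> where "\<pi> x = ?D #> x" for x
  have pi_hom: "\<pi> (x \<otimes> y) = \<pi> x \<otimes>\<^bsub>G Mod ?D\<^esub> \<pi> y" "\<pi> (inv x) = inv\<^bsub>G Mod ?D\<^esub> \<pi> x"
    "\<pi> x \<in> carrier (G Mod ?D)" if "x \<in> carrier G" "y \<in> carrier G" for x y
    using that by (simp_all add: \<pi>_def)
  have sub: "coprime_order p \<subseteq> carrier G" by (auto simp: coprime_order_def)
  have fin: "finite (coprime_order p)" using sub finite_carrier finite_subset by blast
  let ?Y = "\<pi> ` coprime_order p"
  have "finite (generate (G Mod ?D) ?Y) \<and> card (generate (G Mod ?D) ?Y) \<le> card ?Y ^ card ?Y"
  proof (rule L.dietzmann)
    show "?Y \<subseteq> carrier (G Mod ?D)" using pi_hom(3) sub by blast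
    show "finite ?Y" using fin by simp
    have "\<one>\<^bsub>G Mod ?D\<^esub> = \<pi> \<one>" by (simp add: \<pi>_def)
    then show "\<one>\<^bsub>G Mod ?D\<^esub> \<in> ?Y" using one_coprime_order by blast
    show "inv\<^bsub>G Mod ?D\<^esub> x \<in> ?Y" if "x \<in> ?Y" for x
      using that sub coprime_order_inv pi_hom(2) by (metis (no_types, lifting) imageE image_eqI subsetD)
    show "x \<otimes>\<^bsub>G Mod ?D\<^esub> x \<in> ?Y" if x: "x \<in> ?Y" for x
    proof -
      obtain y where y: "y \<in> coprime_order p" "x = \<pi> y" using x by blast
      then have "y \<in> carrier G" using sub by blast
      then have "x \<otimes>\<^bsub>G Mod ?D\<^esub> x = \<pi> (y [^] (2::nat))" using y by (simp add: pi_hom numeral_2_eq_2)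
      then show ?thesis using coprime_order_pow y by blast
    qed
    show "L.conjugate x y \<in> ?Y" if xy: "x \<in> ?Y" "y \<in> ?Y" for x y
    proof -
      obtain g h where gh: "g \<in> coprime_order p" "x = \<pi> g" "h \<in> coprime_order p" "y = \<pi> h" using xy by blast
      then have c: "g \<in> carrier G" "h \<in> carrier G" using sub by auto
      then have "L.conjugate x y = \<pi> (conjugate g h)"
        using gh by (simp add: L.conjugate_def conjugate_def pi_hom)
      then show ?thesis using coprime_order_conj gh c by blast
    qed
  qed
  moreover have "generate (G Mod ?D) ?Y = \<pi> ` ?R"
    using \<pi>.generate_img[OF sub] by (simp add: \<pi>_def)
  moreover have "card ?Y \<le> order Q"
  proof -
    have "card ?Y \<le> card (\<kappa> ` coprime_order p)"
    proof (rule card_image_le_by_fibres[THEN conjunct2])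
      show "finite (\<kappa> ` coprime_order p)" using fin by simp
      show "\<pi> x = \<pi> y" if "x \<in> coprime_order p" "y \<in> coprime_order p" "\<kappa> x = \<kappa> y" for x y
        using coprime_order_determined_by_image[OF p that] by (simp add: \<pi>_def)
    qed
    also have "\<dots> \<le> order Q"
      unfolding order_def using kappa sub Q(2) by (intro card_mono) (auto simp: hom_def)
    finally show ?thesis .
  qed
  moreover have "card ?Y > 0" using fin one_coprime_order by (auto simp: card_gt_0_iff)
  ultimately have R: "finite (\<pi> ` ?R)" "card (\<pi> ` ?R) \<le> order Q ^ order Q"
    using nat_self_power_mono[of "card ?Y" "order Q"] by auto
  have finA: "finite A" using finite_carrier A.subset finite_subset by blast
  have "\<pi> ` carrier G \<subseteq> (\<lambda>(r, a). r \<otimes>\<^bsub>G Mod ?D\<^esub> \<pi> a) ` (\<pi> ` ?R \<times> A)"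
  proof
    fix z assume "z \<in> \<pi> ` carrier G"
    then obtain r a where "r \<in> ?R" "a \<in> A" "z = \<pi> (r \<otimes> a)"
      using carrier_eq_coprime_order_times_A[OF p] by (auto simp: set_mult_def)
    moreover have "r \<in> carrier G" using \<open>r \<in> ?R\<close> generate_in_carrier[OF sub] by blast
    ultimately have "z = (\<lambda>(r, a). r \<otimes>\<^bsub>G Mod ?D\<^esub> \<pi> a) (\<pi> r, a)" "(\<pi> r, a) \<in> \<pi> ` ?R \<times> A"
      using A.mem_carrier by (auto simp: pi_hom)
    then show "z \<in> (\<lambda>(r, a). r \<otimes>\<^bsub>G Mod ?D\<^esub> \<pi> a) ` (\<pi> ` ?R \<times> A)" by (rule image_eqI)
  qed
  then have "card (\<pi> ` carrier G) \<le> card (\<pi> ` ?R \<times> A)"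
    using R finA by (intro surj_card_le) auto
  also have "\<dots> \<le> order Q ^ order Q * card A" using R by (simp add: card_cartesian_product)
  finally show ?thesis by (simp add: \<pi>_def[abs_def])
qed

lemma card_conjugates_le:
  assumes p: "Factorial_Ring.prime p" and h: "h \<in> prime_power_order p"
  shows "card (conjugate h ` carrier G) \<le> order Q ^ order Q * card A"
proof -
  let ?D = "kernel_centralizer p"
  interpret D: normal ?D G by (rule kernel_centralizer_normal)
  have hc: "h \<in> carrier G" using h by (rule prime_power_carrier)
  have "conjugate h x = conjugate h y"
    if x: "x \<in> carrier G" "y \<in> carrier G" "?D #> x = ?D #> y" for x y
  proof -
    have d: "x \<otimes> inv y \<in> ?D" using x by (simp add: rcoset_eq_iff[OF D.subgroup_axioms])
    have "conjugate h x = conjugate h ((x \<otimes> inv y) \<otimes> y)" using x by (simp add: m_assoc)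
    also have "\<dots> = conjugate (conjugate h (x \<otimes> inv y)) y"
      by (rule conjugate_conjugate[symmetric]) (use x hc in simp_all)
    also have "conjugate h (x \<otimes> inv y) = h" using d h unfolding kernel_centralizer_def by blast
    finally show ?thesis .
  qed
  then have "card (conjugate h ` carrier G) \<le> card ((\<lambda>x. ?D #> x) ` carrier G)"
    by (rule card_image_le_by_fibres[THEN conjunct2, rotated]) (simp_all add: finite_carrier)
  with index_kernel_centralizer[OF p] show ?thesis by linarith
qed

text \<open>\<open>G\<close> is generated by the conjugates of the elements of \<open>A\<close> of prime power order.  There
  are at most \<open>card A\<close> such elements with at most \<open>order Q ^ order Q * card A\<close> conjugates each.\<close>

theorem card_carrier_le:
  "card (carrier G) \<le>
    (card A * (order Q ^ order Q * card A)) ^ (card A * (order Q ^ order Q * card A))"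
proof -
  let ?B = "order Q ^ order Q * card A"
  interpret A: subgroup A G by (rule A)
  define P where "P = {h \<in> A. \<exists>p. Factorial_Ring.prime p \<and> h \<in> prime_power_order p}"
  have finA: "finite A" using finite_carrier A.subset finite_subset by blast
  have P: "P \<subseteq> A" "finite P" using finA by (auto simp: P_def)
  have Pc: "h \<in> carrier G" if "h \<in> P" for h using that P A.mem_carrier by blast
  define Y where "Y = (\<Union>h\<in>P. conjugate h ` carrier G)"
  have Y: "Y \<subseteq> carrier G" using Pc by (auto simp: Y_def)
  have finY: "finite Y" using Y finite_carrier finite_subset by blast
  have one: "\<one> \<in> P"
    using two_is_prime_nat by (auto simp: P_def prime_power_order_def)
  have P_Y: "P \<subseteq> Y"
  proof
    fix h assume "h \<in> P"
    then show "h \<in> Y" using conjugate_one[OF Pc] unfolding Y_def by (metis UN_I image_eqI one_closed)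
  qed
  have conj_Y: "conjugate y g \<in> Y" if "y \<in> Y" "g \<in> carrier G" for y g
    using that Pc by (fastforce simp: Y_def conjugate_conjugate)
  have "card Y \<le> (\<Sum>h\<in>P. card (conjugate h ` carrier G))"
    unfolding Y_def by (rule card_UN_le[OF P(2)])
  also have "\<dots> \<le> (\<Sum>h\<in>P. ?B)"
    by (rule sum_mono) (auto simp: P_def intro: card_conjugates_le)
  also have "\<dots> \<le> card A * ?B" using card_mono[OF finA P(1)] by simp
  finally have card_Y: "card Y \<le> card A * ?B" .
  have "card (generate G Y) \<le> card Y ^ card Y"
  proof (rule dietzmann[OF Y finY, THEN conjunct2])
    show "\<one> \<in> Y" using one P_Y by blast
    show "inv y \<in> Y" if y: "y \<in> Y" for y
    proof -
      obtain h g where h: "h \<in> P" "g \<in> carrier G" "y = conjugate h g" using y by (auto simp: Y_def)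
      then have "inv h \<in> P" by (auto simp: P_def intro: prime_power_order_inv)
      moreover have "inv y = conjugate (inv h) g" using h Pc by (simp add: conjugate_inv)
      ultimately show ?thesis using h by (auto simp: Y_def)
    qed
    show "y \<otimes> y \<in> Y" if y: "y \<in> Y" for y
    proof -
      obtain h g where h: "h \<in> P" "g \<in> carrier G" "y = conjugate h g" using y by (auto simp: Y_def)
      have "h \<otimes> h = h [^] (2::nat)" using h Pc by (simp add: numeral_2_eq_2)
      then have "h \<otimes> h \<in> P"
        using h prime_power_order_pow[of h _ 2] subgroup_pow_closed[OF A, of h 2]
        by (auto simp: P_def)
      moreover have "y \<otimes> y = conjugate (h \<otimes> h) g" using h Pc by (simp add: conjugate_mult)
      ultimately show ?thesis using h by (auto simp: Y_def)
    qed
  qed (use conj_Y Y in blast)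
  moreover have "generate G Y = carrier G"
  proof (rule normal_closure_A)
    show "generate G Y \<lhd> G"
    proof (rule normal_generateI[OF Y])
      fix h g assume "h \<in> Y" "g \<in> carrier G"
      then show "g \<otimes> h \<otimes> inv g \<in> Y" using conj_Y[of h "inv g"] by (simp add: conjugate_def)
    qed
    show "A \<subseteq> generate G Y"
    proof
      fix x assume x: "x \<in> A"
      have "x [^] order G = \<one>" "order G > 0"
        using x finite_carrier pow_order_eq_1 order_gt_0_iff_finite by auto
      then have "x \<in> generate G P" unfolding P_def using generated_by_prime_power_orders[OF A x] by blast
      then show "x \<in> generate G Y" using mono_generate[OF P_Y] by blast
    qed
  qed
  moreover have "card Y > 0" using finY one P_Y by (auto simp: card_gt_0_iff)
  ultimately show ?thesis
    using nat_self_power_mono[OF _ card_Y] by simp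
qed

end

section \<open>Normal closures of finite groups\<close>

context normal_map
begin

lemma kernel_central:
  "\<lbrakk>m \<in> carrier M; k \<in> carrier M; n k = \<one>\<^bsub>G\<^esub>\<rbrakk> \<Longrightarrow> m \<otimes>\<^bsub>M\<^esub> k = k \<otimes>\<^bsub>M\<^esub> m"
  by (simp add: peiffer_swap[of m k] act_one)

lemma act_inv: "\<lbrakk>m \<in> carrier M; g \<in> carrier G\<rbrakk> \<Longrightarrow> act (inv\<^bsub>M\<^esub> m) g = inv\<^bsub>M\<^esub> act m g"
  by (rule M.inv_equality[symmetric]) (simp_all add: act_id flip: act_hom)

lemma conjugate_eq_act: "\<lbrakk>m \<in> carrier M; m' \<in> carrier M\<rbrakk> \<Longrightarrow> M.conjugate m m' = act m (n m')"
  by (simp add: M.conjugate_def peiffer)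

lemma act_generate:
  assumes Y: "Y \<subseteq> carrier M" and inv: "\<And>y g. \<lbrakk>y \<in> Y; g \<in> carrier G\<rbrakk> \<Longrightarrow> act y g \<in> Y"
    and g: "g \<in> carrier G" and m: "m \<in> generate M Y"
  shows "act m g \<in> generate M Y"
  using m
proof induction
  case one then show ?case using g by (simp add: act_id generate.one)
next
  case (incl h) then show ?case using inv g by (simp add: generate.incl)
next
  case (inv h)
  then have "act (inv\<^bsub>M\<^esub> h) g = inv\<^bsub>M\<^esub> act h g" using Y g by (intro act_inv) auto
  then show ?case using generate.inv[OF assms(2)[OF inv g], of M] by simp
next
  case (eng h1 h2)
  then show ?case using Y g M.generate_in_carrier[OF Y] by (simp add: act_hom generate.eng)
qed

lemma normal_map_generate:
  assumes Y: "Y \<subseteq> carrier M" and inv: "\<And>y g. \<lbrakk>y \<in> Y; g \<in> carrier G\<rbrakk> \<Longrightarrow> act y g \<in> Y"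
  shows "normal_map (M\<lparr>carrier := generate M Y\<rparr>) G n act"
proof -
  have sub: "subgroup (generate M Y) M" by (rule M.generate_is_subgroup[OF Y])
  interpret S: subgroup "generate M Y" M by (rule sub)
  interpret K: group "M\<lparr>carrier := generate M Y\<rparr>" by (rule S.subgroup_is_group[OF M.is_group])
  note act_gen = act_generate[OF Y inv]
  show ?thesis
  proof unfold_locales
    fix g assume g: "g \<in> carrier G"
    show "(\<lambda>m. act m g) \<in> iso (M\<lparr>carrier := generate M Y\<rparr>) (M\<lparr>carrier := generate M Y\<rparr>)"
    proof (rule isoI)
      show "(\<lambda>m. act m g) \<in> hom (M\<lparr>carrier := generate M Y\<rparr>) (M\<lparr>carrier := generate M Y\<rparr>)"
        using g act_gen by (auto simp: hom_def act_hom)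
      show "bij_betw (\<lambda>m. act m g) (carrier (M\<lparr>carrier := generate M Y\<rparr>))
          (carrier (M\<lparr>carrier := generate M Y\<rparr>))"
        using g act_gen
        by (intro bij_betw_byWitness[where f' = "\<lambda>m. act m (inv\<^bsub>G\<^esub> g)"])
          (auto simp: act_one simp flip: act_mult)
    qed
  qed (use n_hom sub in \<open>auto simp: hom_def act_one act_mult equivariant peiffer M.m_inv_consistent\<close>)
qed

end

text \<open>The subgroup generated by the elements \<open>c(x)\<^sup>g\<close> is stable under the action and so is itself a normal map
  through which \<open>\<phi>\<close> factors.  The universal morphism into it, followed by the inclusion, must be the
  identity.\<close>

lemma normal_closure_generated:
  fixes N :: "'n monoid"
  assumes \<Gamma>: "group \<Gamma>" and N: "normal_closure \<Gamma> G \<phi> N c b act"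
  shows "generate N ((\<lambda>(x, g). act (c x) g) ` (carrier \<Gamma> \<times> carrier G)) = carrier N"
proof -
  let ?Y = "(\<lambda>(x, g). act (c x) g) ` (carrier \<Gamma> \<times> carrier G)"
  let ?K = "N\<lparr>carrier := generate N ?Y\<rparr>"
  have fac: "normal_factorization \<Gamma> G \<phi> N c b act" and univ: "universal_over TYPE('n) \<Gamma> G N c b act \<phi>"
    using N by (auto simp: normal_closure_def)
  interpret normal_map N G b act using fac by (simp add: normal_factorization_def)
  have c: "c \<in> hom \<Gamma> N" "\<forall>x\<in>carrier \<Gamma>. b (c x) = \<phi> x" using fac by (auto simp: normal_factorization_def)
  have cc: "c x \<in> carrier N" if "x \<in> carrier \<Gamma>" for x using c that by (auto simp: hom_def)
  have Y: "?Y \<subseteq> carrier N" using cc by auto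
  have inv: "act y g \<in> ?Y" if "y \<in> ?Y" "g \<in> carrier G" for y g
  proof -
    obtain x h where xh: "x \<in> carrier \<Gamma>" "h \<in> carrier G" "y = act (c x) h" using \<open>y \<in> ?Y\<close> by auto
    then have "act y g = act (c x) (h \<otimes>\<^bsub>G\<^esub> g)" using that cc by (simp add: act_mult)
    then show ?thesis using xh that by force
  qed
  have K: "normal_map ?K G b act" using Y inv by (rule normal_map_generate)
  have cK: "c x \<in> generate N ?Y" if "x \<in> carrier \<Gamma>" for x
  proof (rule generate.incl)
    have "c x = act (c x) \<one>\<^bsub>G\<^esub>" using cc[OF that] by (simp add: act_one)
    then show "c x \<in> ?Y" using that by force
  qed
  have "normal_factorization \<Gamma> G \<phi> ?K c b act"
    using K c cK by (auto simp: normal_factorization_def hom_def)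
  then obtain u where u: "normal_morphism G N b act ?K b act u" "\<And>x. x \<in> carrier \<Gamma> \<Longrightarrow> u (c x) = c x"
    using universal_over_ex[OF univ] by blast
  have uK: "u m \<in> generate N ?Y" if "m \<in> carrier N" for m
    using u(1) that by (auto simp: normal_morphism_def hom_def)
  have gen_sub: "generate N ?Y \<subseteq> carrier N" by (rule M.generate_incl[OF Y])
  have uN: "normal_morphism G N b act N b act u"
    using u(1) gen_sub by (auto simp: normal_morphism_def hom_def)
  have idN: "normal_morphism G N b act N b act (\<lambda>x. x)"
    by (simp add: normal_morphism_def hom_def)
  have "u m = m" if "m \<in> carrier N" for m
    using universal_over_unique[OF univ fac normal_map_axioms uN idN _ that] u(2) by simp
  then show ?thesis using uK gen_sub by force
qed

text \<open>Dietzmann's lemma for the elements \<open>c(x)\<^sup>g\<close>.  By the Peiffer identity, conjugation by \<open>m\<close> is the action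
  of \<open>b m\<close> and permutes them.\<close>

lemma normal_closure_finite:
  assumes \<Gamma>: "group \<Gamma>" "finite (carrier \<Gamma>)" and G: "finite (carrier G)"
    and N: "normal_closure \<Gamma> G \<phi> N c b act"
  shows "finite (carrier N)"
proof -
  let ?Y = "(\<lambda>(x, g). act (c x) g) ` (carrier \<Gamma> \<times> carrier G)"
  have fac: "normal_factorization \<Gamma> G \<phi> N c b act" using N by (auto simp: normal_closure_def)
  interpret normal_map N G b act using fac by (simp add: normal_factorization_def)
  interpret c: group_hom \<Gamma> N c
    using fac \<Gamma> M.is_group by (simp add: normal_factorization_def group_hom_def group_hom_axioms_def)
  have mem: "act (c x) g \<in> ?Y" if "x \<in> carrier \<Gamma>" "g \<in> carrier G" for x g using that by force
  have "finite (generate N ?Y) \<and> card (generate N ?Y) \<le> card ?Y ^ card ?Y"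
  proof (rule M.dietzmann)
    show "?Y \<subseteq> carrier N" by auto
    show "finite ?Y" using \<Gamma> G by simp
    have "\<one>\<^bsub>N\<^esub> = act (c \<one>\<^bsub>\<Gamma>\<^esub>) \<one>\<^bsub>G\<^esub>" by (simp add: act_one)
    then show "\<one>\<^bsub>N\<^esub> \<in> ?Y" using mem[OF c.G.one_closed G.one_closed] by (simp only:)
    fix y assume "y \<in> ?Y"
    then obtain x g where y: "x \<in> carrier \<Gamma>" "g \<in> carrier G" "y = act (c x) g" by auto
    have "inv\<^bsub>N\<^esub> y = act (c (inv\<^bsub>\<Gamma>\<^esub> x)) g" using y by (simp add: act_inv)
    then show "inv\<^bsub>N\<^esub> y \<in> ?Y" using y by (simp only:) (simp add: mem del: c.hom_inv c.hom_mult)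
    have "y \<otimes>\<^bsub>N\<^esub> y = act (c (x \<otimes>\<^bsub>\<Gamma>\<^esub> x)) g" using y by (simp add: act_hom)
    then show "y \<otimes>\<^bsub>N\<^esub> y \<in> ?Y" using y by (simp only:) (simp add: mem del: c.hom_inv c.hom_mult)
    fix y' assume "y' \<in> ?Y"
    then have "y' \<in> carrier N" by auto
    then have "M.conjugate y y' = act (c x) (g \<otimes>\<^bsub>G\<^esub> b y')"
      using y by (simp add: conjugate_eq_act act_mult)
    then show "M.conjugate y y' \<in> ?Y" using mem[OF y(1), of "g \<otimes>\<^bsub>G\<^esub> b y'"] y \<open>y' \<in> carrier N\<close> by simp
  qed
  then show ?thesis using normal_closure_generated[OF \<Gamma>(1) N] by simp
qed

section \<open>Stable images in the tower\<close>

text \<open>If \<open>x\<close> and \<open>y\<close> commute up to a central \<open>z\<close>, then both \<open>z\<^sup>a\<close> and \<open>z\<^sup>b\<close> are trivial: \<open>x \<otimes> z\<close> is a conjugate of \<open>x\<close>,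
  and conjugating \<open>x\<close> by \<open>y\<^sup>b = \<one>\<close> multiplies it by \<open>z\<^sup>b\<close>.\<close>

lemma (in group) coprime_commute_modulo_central:
  assumes x: "x \<in> carrier G" "x [^] (a::nat) = \<one>" and y: "y \<in> carrier G" "y [^] (b::nat) = \<one>"
    and ab: "coprime a b" and z: "z \<in> carrier G" "\<And>w. w \<in> carrier G \<Longrightarrow> w \<otimes> z = z \<otimes> w"
    and xy: "x \<otimes> y = y \<otimes> x \<otimes> z"
  shows "x \<otimes> y = y \<otimes> x"
proof -
  have "y \<otimes> conjugate x y = y \<otimes> (x \<otimes> z)"
    using mult_conjugate[OF x(1) y(1)] xy m_assoc[OF y(1) x(1) z(1)] by simp
  then have conj: "conjugate x y = x \<otimes> z" using x y z(1) by simp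
  have zn: "z [^] n \<in> carrier G" for n :: nat using z by simp
  have zy: "conjugate (z [^] n) y = z [^] n" for n :: nat
    using z y conjugate_eq_self_iff[OF z(1) y(1)] by (simp flip: conjugate_pow)
  have pow: "conjugate x (y [^] n) = x \<otimes> z [^] n" for n :: nat
  proof (induction n)
    case (Suc n)
    have "conjugate x (y [^] Suc n) = conjugate (conjugate x (y [^] n)) y"
      using x y by (simp add: conjugate_conjugate)
    also have "\<dots> = conjugate x y \<otimes> conjugate (z [^] n) y" using Suc x y z by (simp add: conjugate_mult)
    also have "\<dots> = x \<otimes> z [^] Suc n"
      unfolding conj zy using x z(1) by (simp add: m_assoc z(2)[OF zn[of n]])
    finally show ?case .
  qed (use x in simp)
  have "x = x \<otimes> z [^] b" using pow[of b] x y by simp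
  then have zb: "z [^] b = \<one>" using x z l_cancel_one by (metis zn)
  have "(x \<otimes> z) [^] a = \<one>" using x y conjugate_pow[of x y a] conj by simp
  then have za: "z [^] a = \<one>" using x z by (simp add: pow_mult_distrib)
  obtain k :: nat where "(z [^] b) [^] k = z" using pow_coprime_generates[OF z(1) za ab] .
  then have "z = \<one>" using zb by simp
  then show ?thesis using xy x y by simp
qed

locale finite_closures_tower =
  fixes \<Gamma> :: "'a monoid" and T :: "nat \<Rightarrow> 'g monoid" and f :: "nat \<Rightarrow> 'a \<Rightarrow> 'g"
    and d :: "nat \<Rightarrow> 'g \<Rightarrow> 'g" and act :: "nat \<Rightarrow> 'g \<Rightarrow> 'g \<Rightarrow> 'g"
  assumes Gamma: "group \<Gamma>" "finite (carrier \<Gamma>)"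
    and bottom: "group (T 1)" "finite (carrier (T 1))" "f 1 \<in> hom \<Gamma> (T 1)"
    and closures: "i \<ge> 1 \<Longrightarrow> normal_closure \<Gamma> (T i) (f i) (T (Suc i)) (f (Suc i)) (d i) (act i)"
begin

lemma factorization:
  "i \<ge> 1 \<Longrightarrow> normal_factorization \<Gamma> (T i) (f i) (T (Suc i)) (f (Suc i)) (d i) (act i)"
  using closures by (simp add: normal_closure_def)

lemma normal_map: "i \<ge> 1 \<Longrightarrow> normal_map (T (Suc i)) (T i) (d i) (act i)"
  using factorization by (simp add: normal_factorization_def)

lemma T_group: "i \<ge> 1 \<Longrightarrow> group (T i)"
  using normal_map[of i] by (simp add: normal_map_def)

lemma f_hom: "i \<ge> 1 \<Longrightarrow> f i \<in> hom \<Gamma> (T i)"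
proof (induction i rule: dec_induct)
  case base then show ?case by (rule bottom)
next
  case (step i) then show ?case using factorization[of i] by (simp add: normal_factorization_def)
qed

lemma T_finite: "i \<ge> 1 \<Longrightarrow> finite (carrier (T i))"
proof (induction i rule: dec_induct)
  case base then show ?case by (rule bottom)
next
  case (step i) then show ?case using normal_closure_finite[OF Gamma step.IH] closures[of i] by simp
qed

lemma d_hom: "i \<ge> 1 \<Longrightarrow> d i \<in> hom (T (Suc i)) (T i)"
  using normal_map normal_map.n_hom by blast

lemma d_f: "\<lbrakk>i \<ge> 1; x \<in> carrier \<Gamma>\<rbrakk> \<Longrightarrow> d i (f (Suc i) x) = f i x"
  using factorization by (simp add: normal_factorization_def)

text \<open>The composite \<open>T (i + k) \<rightarrow> T i\<close> of the normal maps of the tower.\<close>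

primrec down :: "nat \<Rightarrow> nat \<Rightarrow> 'g \<Rightarrow> 'g" where
  "down i 0 x = x"
| "down i (Suc k) x = down i k (d (i + k) x)"

lemma down_hom: "i \<ge> 1 \<Longrightarrow> down i k \<in> hom (T (i + k)) (T i)"
proof (induction k)
  case (Suc k)
  have eq: "down i (Suc k) = down i k \<circ> d (i + k)" by auto
  show ?case unfolding eq using hom_compose[OF d_hom[of "i + k"] Suc.IH] Suc.prems
    by (simp add: comp_def)
qed (simp add: hom_def)

lemma down_f: "\<lbrakk>i \<ge> 1; x \<in> carrier \<Gamma>\<rbrakk> \<Longrightarrow> down i k (f (i + k) x) = f i x"
  by (induction k) (simp_all add: d_f)

text \<open>Each level adds a central kernel, so \<open>coprime_commute_modulo_central\<close> lifts the commutation of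
  elements of coprime order from one level to the next.\<close>

lemma kernel_commutes:
  assumes "x \<in> carrier (T (1 + k))" "down 1 k x = \<one>\<^bsub>T 1\<^esub>" "y \<in> carrier (T (1 + k))"
    and ab: "coprime a b" and "x [^]\<^bsub>T (1 + k)\<^esub> (a::nat) = \<one>\<^bsub>T (1 + k)\<^esub>"
    "y [^]\<^bsub>T (1 + k)\<^esub> (b::nat) = \<one>\<^bsub>T (1 + k)\<^esub>"
  shows "x \<otimes>\<^bsub>T (1 + k)\<^esub> y = y \<otimes>\<^bsub>T (1 + k)\<^esub> x"
  using assms(1-3,5,6)
proof (induction k arbitrary: x y)
  case 0
  interpret group "T (Suc 0)" using bottom by simp
  show ?case using 0 by simp
next
  case (Suc k)
  let ?N = "T (Suc (Suc k))" and ?G = "T (Suc k)"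
  interpret normal_map ?N ?G "d (Suc k)" "act (Suc k)" by (rule normal_map) simp
  interpret d: group_hom ?N ?G "d (Suc k)"
    using n_hom M.is_group G.is_group by (simp add: group_hom_def group_hom_axioms_def)
  have xy: "x \<in> carrier ?N" "y \<in> carrier ?N" "x [^]\<^bsub>?N\<^esub> a = \<one>\<^bsub>?N\<^esub>" "y [^]\<^bsub>?N\<^esub> b = \<one>\<^bsub>?N\<^esub>"
    using Suc.prems by simp_all
  have "d (Suc k) x \<otimes>\<^bsub>?G\<^esub> d (Suc k) y = d (Suc k) y \<otimes>\<^bsub>?G\<^esub> d (Suc k) x"
  proof -
    have "d (Suc k) x [^]\<^bsub>?G\<^esub> a = \<one>\<^bsub>?G\<^esub>" "d (Suc k) y [^]\<^bsub>?G\<^esub> b = \<one>\<^bsub>?G\<^esub>"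
      using d.hom_nat_pow[OF xy(1), of a] d.hom_nat_pow[OF xy(2), of b] d.hom_one xy(3,4) by metis+
    moreover have "down 1 k (d (Suc k) x) = \<one>\<^bsub>T 1\<^esub>" using Suc.prems(2) by simp
    moreover have "d (Suc k) x \<in> carrier ?G" "d (Suc k) y \<in> carrier ?G" using xy by simp_all
    ultimately show ?thesis using Suc.IH[of "d (Suc k) x" "d (Suc k) y"] unfolding plus_1_eq_Suc by blast
  qed
  \<comment> \<open>So the commutator \<open>z\<close> of \<open>x\<close> and \<open>y\<close> lies in the kernel of a normal map, which is central.\<close>
  moreover define z where "z = inv\<^bsub>?N\<^esub> (y \<otimes>\<^bsub>?N\<^esub> x) \<otimes>\<^bsub>?N\<^esub> (x \<otimes>\<^bsub>?N\<^esub> y)"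
  ultimately have "d (Suc k) z = \<one>\<^bsub>?G\<^esub>" using xy by simp
  moreover have z: "z \<in> carrier ?N" using xy by (simp add: z_def)
  ultimately have "w \<otimes>\<^bsub>?N\<^esub> z = z \<otimes>\<^bsub>?N\<^esub> w" if "w \<in> carrier ?N" for w
    using kernel_central that by blast
  moreover have "x \<otimes>\<^bsub>?N\<^esub> y = y \<otimes>\<^bsub>?N\<^esub> x \<otimes>\<^bsub>?N\<^esub> z"
    using xy M.inv_mult_cancel(2)[of "y \<otimes>\<^bsub>?N\<^esub> x" "x \<otimes>\<^bsub>?N\<^esub> y"] by (simp add: z_def)
  ultimately have "x \<otimes>\<^bsub>?N\<^esub> y = y \<otimes>\<^bsub>?N\<^esub> x"
    using M.coprime_commute_modulo_central[OF xy(1,3,2,4) ab z] by blast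
  then show ?case by simp
qed

definition image_from :: "nat \<Rightarrow> nat \<Rightarrow> 'g set" where
  "image_from i k = down i k ` carrier (T (i + k))"

lemma image_from_subgroup: "i \<ge> 1 \<Longrightarrow> subgroup (image_from i k) (T i)"
  using group_hom.img_is_subgroup[of "T (i + k)" "T i" "down i k"] T_group down_hom
  by (simp add: image_from_def group_hom_def group_hom_axioms_def)

text \<open>The images form a decreasing chain of finite sets.\<close>

lemma image_from_stabilizes:
  assumes i: "i \<ge> 1"
  obtains k where "image_from i (Suc k) = image_from i k"
proof -
  obtain k where k: "\<And>l. card (image_from i k) \<le> card (image_from i l)"
    using ex_has_least_nat[of "\<lambda>_. True" _ "\<lambda>k. card (image_from i k)"] by auto
  have "image_from i (Suc k) \<subseteq> image_from i k"
    using d_hom[of "i + k"] i by (auto simp: image_from_def hom_def)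
  moreover have "finite (image_from i k)" using T_finite i by (simp add: image_from_def)
  ultimately show thesis using that[of k] k[of "Suc k"] card_seteq by blast
qed

text \<open>The generators \<open>c(x)\<^sup>g\<close> of \<open>T (i + k + 1)\<close> are mapped to conjugates of the elements \<open>f i x\<close> by elements
  of the image of \<open>T (i + k)\<close>.  A normal subgroup of this image that contains the elements \<open>f i x\<close> therefore
  contains the next image, which by stability is the same.\<close>

lemma image_from_normally_generated:
  assumes i: "i \<ge> 1" and stable: "image_from i (Suc k) = image_from i k"
    and N: "N \<lhd> T i\<lparr>carrier := image_from i k\<rparr>" "f i ` carrier \<Gamma> \<subseteq> N"
  shows "N = image_from i k"
proof
  let ?S = "image_from i k"
  interpret S: subgroup ?S "T i" by (rule image_from_subgroup[OF i])
  interpret Ti: group "T i" by (rule T_group[OF i])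
  interpret N: normal N "T i\<lparr>carrier := ?S\<rparr>" by (rule N)
  show NS: "N \<subseteq> ?S" using N.subset by simp
  let ?j = "i + k"
  have j: "?j \<ge> 1" using i by simp
  interpret normal_map "T (Suc ?j)" "T ?j" "d ?j" "act ?j" by (rule normal_map[OF j])
  interpret h: group_hom "T (Suc ?j)" "T i" "down i (Suc k)"
    using down_hom[OF i, of "Suc k"] M.is_group Ti.is_group by (simp add: group_hom_def group_hom_axioms_def)
  interpret h': group_hom "T ?j" "T i" "down i k"
    using down_hom[OF i, of k] G.is_group Ti.is_group by (simp add: group_hom_def group_hom_axioms_def)
  have NT: "subgroup N (T i)"
    using Ti.incl_subgroup[OF S.subgroup_axioms N.subgroup_axioms] .
  interpret NT: subgroup N "T i" by (rule NT)
  define P where "P = {t \<in> carrier (T (Suc ?j)). down i (Suc k) t \<in> N}"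
  have P: "subgroup P (T (Suc ?j))"
  proof (rule M.subgroupI)
    have "\<one>\<^bsub>T (Suc ?j)\<^esub> \<in> P" using h.hom_one NT.one_closed by (simp add: P_def del: down.simps)
    then show "P \<noteq> {}" by blast
  qed (auto simp: P_def simp del: down.simps)
  have "(\<lambda>(x, g). act ?j (f (Suc ?j) x) g) ` (carrier \<Gamma> \<times> carrier (T ?j)) \<subseteq> P"
  proof clarify
    fix x g assume x: "x \<in> carrier \<Gamma>" and g: "g \<in> carrier (T ?j)"
    have fx: "f (Suc ?j) x \<in> carrier (T (Suc ?j))" "f ?j x \<in> carrier (T ?j)"
      using f_hom[of "Suc ?j"] f_hom[OF j] x by (auto simp: hom_def)
    let ?g = "down i k g"
    have gS: "?g \<in> ?S" using g by (simp add: image_from_def)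
    have "down i (Suc k) (act ?j (f (Suc ?j) x) g) = inv\<^bsub>T i\<^esub> ?g \<otimes>\<^bsub>T i\<^esub> f i x \<otimes>\<^bsub>T i\<^esub> ?g"
      using fx g x i d_f[OF j x] by (simp add: equivariant down_f)
    also have "\<dots> \<in> N"
      using N.inv_op_closed1[of ?g "f i x"] gS N(2) x S.subgroup_axioms by auto
    finally show "act ?j (f (Suc ?j) x) g \<in> P" using fx g by (simp add: P_def del: down.simps)
  qed
  then have "carrier (T (Suc ?j)) \<subseteq> P"
    using M.generate_subgroup_incl[OF _ P] normal_closure_generated[OF Gamma(1) closures[OF j]] by blast
  then have "image_from i (Suc k) \<subseteq> N" by (auto simp: image_from_def P_def simp del: down.simps)
  then show "?S \<subseteq> N" using stable by simp
qed

text \<open>The bound does not depend on the level \<open>Suc k\<close>; this is what makes the limit finite.\<close>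

lemma stable_image_bounded:
  assumes stable: "image_from (Suc k) (Suc l) = image_from (Suc k) l"
  shows "card (image_from (Suc k) l) \<le>
    (let c = card (carrier \<Gamma>) * (order (T 1) ^ order (T 1) * card (carrier \<Gamma>)) in c ^ c)"
proof -
  let ?S = "image_from (Suc k) l" and ?A = "f (Suc k) ` carrier \<Gamma>"
  interpret T: group "T (Suc k)" by (rule T_group) simp
  interpret S: subgroup ?S "T (Suc k)" by (rule image_from_subgroup) simp
  interpret f: group_hom \<Gamma> "T (Suc k)" "f (Suc k)"
    using f_hom[of "Suc k"] Gamma T.is_group by (simp add: group_hom_def group_hom_axioms_def)
  have A: "subgroup ?A (T (Suc k))" by (rule f.img_is_subgroup)
  have AS: "?A \<subseteq> ?S"
  proof clarify
    fix x assume x: "x \<in> carrier \<Gamma>"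
    then have "f (Suc k) x = down (Suc k) l (f (Suc k + l) x)" using down_f[of "Suc k" x l] by simp
    moreover have "f (Suc k + l) x \<in> carrier (T (Suc k + l))"
      using f_hom[of "Suc k + l"] x by (auto simp: hom_def)
    ultimately show "f (Suc k) x \<in> ?S" unfolding image_from_def by blast
  qed
  let ?G = "T (Suc k)\<lparr>carrier := ?S\<rparr>"
  interpret E: normally_generated_extension ?G "T 1" "down 1 k" ?A
  proof (intro normally_generated_extension.intro normally_generated_extension_axioms.intro)
    show "group ?G" by (rule S.subgroup_is_group[OF T.is_group])
    show "finite (carrier ?G)" using T_finite[of "Suc k"] S.subset finite_subset by auto
    show "down 1 k \<in> hom ?G (T 1)"
      using down_hom[of 1 k] S.subset by (auto simp: hom_def)
    show "subgroup ?A ?G" using T.subgroup_incl[OF A S.subgroup_axioms AS] .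
    show "N = carrier ?G" if "N \<lhd> ?G" "?A \<subseteq> N" for N
      using image_from_normally_generated[OF _ stable that] by simp
    show "x \<otimes>\<^bsub>?G\<^esub> y = y \<otimes>\<^bsub>?G\<^esub> x"
      if "x \<in> carrier ?G" "down 1 k x = \<one>\<^bsub>T 1\<^esub>" "y \<in> carrier ?G" "coprime a b"
        "x [^]\<^bsub>?G\<^esub> (a::nat) = \<one>\<^bsub>?G\<^esub>" "y [^]\<^bsub>?G\<^esub> (b::nat) = \<one>\<^bsub>?G\<^esub>" for x y a b
      using kernel_commutes[of x k y a b] that S.mem_carrier by (simp flip: T.nat_pow_consistent)
  qed (rule bottom)+
  interpret bottom: group "T 1" by (rule bottom)
  let ?q = "order (T 1) ^ order (T 1)"
  have "card ?A \<le> card (carrier \<Gamma>)" using Gamma(2) by (rule card_image_le)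
  then have "card ?A * (?q * card ?A) \<le> card (carrier \<Gamma>) * (?q * card (carrier \<Gamma>))"
    by (intro mult_le_mono) auto
  moreover have "card ?A > 0" "order (T 1) > 0"
    using Gamma(2) f.G.one_closed bottom bottom.order_gt_0_iff_finite
    by (auto simp: card_gt_0_iff)
  ultimately show ?thesis
    using le_trans[OF E.card_carrier_le nat_self_power_mono] by (simp add: Let_def)
qed

section \<open>The inverse limit\<close>

lemma inverse_limit_group: "group (inverse_limit T d)"
proof -
  let ?P = "product_group {1..} T"
  let ?L = "{x \<in> carrier ?P. \<forall>i\<ge>1. d i (x (Suc i)) = x i}"
  have grp: "group (T i)" if "i \<in> {1..}" for i using T_group that by simp
  interpret P: group ?P by (rule product_group) (rule grp)
  have gh: "group_hom (T (Suc i)) (T i) (d i)" if "i \<ge> 1" for i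
    using d_hom T_group that by (simp add: group_hom_def group_hom_axioms_def)
  have "subgroup ?L ?P"
  proof (rule P.subgroupI)
    have "\<one>\<^bsub>?P\<^esub> \<in> ?L" using P.one_closed gh group_hom.hom_one by fastforce
    then show "?L \<noteq> {}" by blast
  next
    fix x assume x: "x \<in> ?L"
    have xi: "x i \<in> carrier (T i)" if "i \<ge> 1" for i using x that by auto
    have "inv\<^bsub>?P\<^esub> x = (\<lambda>i\<in>{1..}. inv\<^bsub>T i\<^esub> x i)" using x grp by (intro inv_product_group) auto
    then have "d i ((inv\<^bsub>?P\<^esub> x) (Suc i)) = (inv\<^bsub>?P\<^esub> x) i" if "i \<ge> 1" for i
      using group_hom.hom_inv[OF gh[OF that], of "x (Suc i)"] x xi[of "Suc i"] that by simp
    then show "inv\<^bsub>?P\<^esub> x \<in> ?L" using x P.inv_closed by blast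
  next
    fix x y assume x: "x \<in> ?L" and y: "y \<in> ?L"
    have xi: "x i \<in> carrier (T i)" "y i \<in> carrier (T i)" if "i \<ge> 1" for i using x y that by auto
    have "d i ((x \<otimes>\<^bsub>?P\<^esub> y) (Suc i)) = (x \<otimes>\<^bsub>?P\<^esub> y) i" if "i \<ge> 1" for i
      using group_hom.hom_mult[OF gh[OF that], of "x (Suc i)" "y (Suc i)"] x y xi[of "Suc i"] that by simp
    then show "x \<otimes>\<^bsub>?P\<^esub> y \<in> ?L" using x y P.m_closed by blast
  qed blast
  then show ?thesis unfolding inverse_limit_def by (rule subgroup.subgroup_is_group) (rule P.is_group)
qed

lemma inverse_limit_component:
  assumes x: "x \<in> carrier (inverse_limit T d)" and i: "i \<ge> 1"
  shows "x i \<in> image_from i k"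
proof -
  have "down i k (x (i + k)) = x i"
    using x i by (induction k) (simp_all add: inverse_limit_def)
  moreover have "x (i + k) \<in> carrier (T (i + k))" using x i by (auto simp: inverse_limit_def)
  ultimately show ?thesis unfolding image_from_def by (metis image_eqI)
qed

lemma inverse_limit_separates:
  assumes "x \<in> carrier (inverse_limit T d)" "y \<in> carrier (inverse_limit T d)" "x \<noteq> y"
  shows "eventually (\<lambda>k. x (Suc k) \<noteq> y (Suc k)) sequentially"
proof -
  have "\<exists>i\<ge>1. x i \<noteq> y i"
  proof (rule ccontr)
    assume "\<not> (\<exists>i\<ge>1. x i \<noteq> y i)"
    then have "x = y" using assms(1,2) by (intro PiE_ext[of x "{1..}" "\<lambda>i. carrier (T i)" y]) (auto simp: inverse_limit_def)
    with assms(3) show False by simp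
  qed
  then obtain i where i: "i \<ge> 1" "x i \<noteq> y i" by blast
  have "x j \<noteq> y j" if "j \<ge> i" for j
    using that
  proof (induction j rule: dec_induct)
    case (step j)
    then have "d j (x (Suc j)) = x j" "d j (y (Suc j)) = y j"
      using assms(1,2) i by (auto simp: inverse_limit_def)
    then show ?case using step.IH by metis
  qed (rule i)
  then show ?thesis unfolding eventually_sequentially by (meson le_SucI)
qed

text \<open>Too many elements of the limit would stay distinct in one component and exceed the bound on the
  stable image there.\<close>

lemma inverse_limit_finite: "finite (carrier (inverse_limit T d))"
proof (rule ccontr)
  let ?L = "carrier (inverse_limit T d)"
  let ?c = "card (carrier \<Gamma>) * (order (T 1) ^ order (T 1) * card (carrier \<Gamma>))"
  assume "infinite ?L"
  then obtain F where F: "F \<subseteq> ?L" "finite F" "card F = Suc (?c ^ ?c)"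
    using infinite_arbitrarily_large by blast
  have "eventually (\<lambda>k. \<forall>p\<in>F \<times> F. fst p \<noteq> snd p \<longrightarrow> fst p (Suc k) \<noteq> snd p (Suc k)) sequentially"
    using F inverse_limit_separates by (intro eventually_ball_finite) (auto simp: subset_iff)
  then obtain k where k: "\<forall>p\<in>F \<times> F. fst p \<noteq> snd p \<longrightarrow> fst p (Suc k) \<noteq> snd p (Suc k)"
    by (auto simp: eventually_sequentially)
  then have "inj_on (\<lambda>x. x (Suc k)) F" by (auto simp: inj_on_def)
  then have "card F = card ((\<lambda>x. x (Suc k)) ` F)" by (simp add: card_image)
  also obtain l where l: "image_from (Suc k) (Suc l) = image_from (Suc k) l"
    using image_from_stabilizes[of "Suc k"] by auto
  have "card ((\<lambda>x. x (Suc k)) ` F) \<le> card (image_from (Suc k) l)"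
    using F inverse_limit_component[of _ "Suc k" l] T_finite[of "Suc k + l"]
    by (intro card_mono) (auto simp: image_from_def)
  also have "\<dots> \<le> ?c ^ ?c" using stable_image_bounded[OF l] by (simp add: Let_def)
  finally show False using F by simp
qed

end

theorem theorem3:
  fixes \<Gamma> :: "'a monoid" and G :: "'g monoid" and \<phi> :: "'a \<Rightarrow> 'g"
    and T :: "nat \<Rightarrow> 'g monoid" and f :: "nat \<Rightarrow> 'a \<Rightarrow> 'g"
    and d :: "nat \<Rightarrow> 'g \<Rightarrow> 'g" and act :: "nat \<Rightarrow> 'g \<Rightarrow> 'g \<Rightarrow> 'g"
  assumes "group \<Gamma>" and "finite (carrier \<Gamma>)"
    and "group G" and "finite (carrier G)"
    and "\<phi> \<in> hom \<Gamma> G"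
    and "normal_closures_tower \<Gamma> G \<phi> T f d act"
  shows "group (inverse_limit T d) \<and> finite (carrier (inverse_limit T d))"
proof -
  interpret finite_closures_tower \<Gamma> T f d act
    by (rule finite_closures_tower.intro) (use assms in \<open>auto simp: normal_closures_tower_def\<close>)
  show ?thesis using inverse_limit_group inverse_limit_finite by blast
qed

end
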